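(* Let $(\lambda^k)$ be the (random) iterates of the SL-CD algorithm applied to $F$. Then SL-CD converges as $$\mathbb{E}\left[F(\lambda^{k+1})\mid\lambda^k\right]-F(\lambda^* )\;\le\;\left(1-\frac{\sigma_{\mathcal L}}{n}\right)\left[F(\lambda^k)-F(\lambda^* )\right],$$ and it holds that $$\sigma_A\,\mathcal L_{\min}\;\le\;\sigma_{\mathcal L}\;\le\;\sigma_A\,\mathcal L_{\max},$$ with $\mathcal L_{\min}=\min_\ell\mathcal L_\ell$ and $\mathcal L_{\max}=\max_\ell\mathcal L_\ell$.
   Context: Setting. $\mathcal{G}=(\mathcal V,\mathcal E)$ is a finite undirected graph with $n=|\mathcal V|$ nodes and $E=|\mathcal E|$ edges; $\ell\equiv(i,j)$ means that edge $\ell$ joins nodes $i$ and $j$. $A\in\mathbb{R}^{n\times E}$ is the incidence matrix: column $\ell\equiv(i,j)$ has one entry $1$ and one entry $-1$, in rows $i$ and $j$ (the sign choice is irrelevant), and zeros elsewhere. For $i=1,\dots,n$, $f_i:\mathbb{R}\to\mathbb{R}$ is $M_i$-smooth and $\mu_i$-strongly convex, i.e. there are constants $M_i\ge\mu_i>0$ such that for all $x,y$: $f_i(x)+f_i'(x)(y-x)+\frac{\mu_i}{2}(y-x)^2\le f_i(y)\le f_i(x)+f_i'(x)(y-x)+\frac{M_i}{2}(y-x)^2$. Put $M_{\max}=\max_iM_i$. $f_i^*(y)=\sup_{x\in\mathbb{R}}(yx-f_i(x))$ is the Fenchel conjugate, and $F:\mathbb{R}^E\to\mathbb{R}$ is $F(\lambda)=\sum_{i=1}^n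 f_i^*(u_i^TA\lambda)$, with $u_i$ the $i$-th standard basis vector of $\mathbb{R}^n$. $\lambda^*$ is a minimizer of $F$. $\nabla_\ell F=\partial F/\partial\lambda_\ell$ and $e_\ell$ is the $\ell$-th standard basis vector of $\mathbb{R}^E$. $\sigma_A=\gamma^+_{\min}/M_{\max}$, with $\gamma^+_{\min}$ the smallest non-zero eigenvalue of $A^TA$; $F$ is $\sigma_A$-strongly convex in the semi-norm $\|x\|_A=(x^TA^+Ax)^{1/2}$, with $A^+$ the pseudo-inverse of $A$. $\mathcal S_i$ is the set of edges incident to node $i$. $L_\ell$ ($\ell=1,\dots,E$) are the coordinate-wise smoothness constants of $F$: $|\nabla_\ell F(\lambda+\alpha e_\ell)-\nabla_\ell F(\lambda)|\le L_\ell|\alpha|$ for $\alpha\in\mathbb{R}$. Define $L^{(i)}=\sum_{m\in\mathcal S_i}L_m$ and, for $\ell\equiv(i,j)$, $\mathcal L_\ell=\frac1{L^{(i)}}+\frac1{L^{(j)}}$. $\|x\|_{\mathcal L}=\sqrt{\sum_{\ell=1}^E\mathcal L_\ell x_\ell^2}$ has dual norm $\|x\|_{\mathcal L}^*=\sqrt{\sum_{\ell=1}^E\frac1{\mathcal L_\ell}x_\ell^2}$. $\sigma_{\mathcal L}$ denotes the strong convexity constant of $F$ in $\|\cdot\|_{\mathcal L}^*$, i.e. the constant in $F(y)\ge F(x)+\langle\nabla F(x),y-x\rangle+\frac{\sigma_{\mathcal L}}{2}(\|y-x\|_{\mathcal L}^* )^2$. SL-CD (Setwise Lipschitz Coordinate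 Descent): at each iteration $k$ a node $i$ is drawn uniformly from $\{1,\dots,n\}$; then an edge $\ell\in\mathcal S_i$ is drawn with probability $p_\ell=L_\ell/\sum_{m\in\mathcal S_i}L_m$, and $\lambda^{k+1}=\lambda^k-\frac1{L_\ell}\nabla_\ell F(\lambda^k)e_\ell$.
   Formalization: σ_𝓛 is the best strong convexity constant of F for y−x in range(Aᵀ) only (the literal one is 0 on graphs with cycles); the upper bound uses as σ_A the best constant in ‖·‖_A, not γ⁺_min/M_max, for which it is false; the lower bound holds with both. *)

theory Defs
  imports "HOL-Analysis.Analysis" "HOL-Probability.Probability"
begin

text \<open>
  The nodes are the elements of a finite type \<open>'n\<close>, the edges those of a finite type \<open>'e\<close>, and
  \<open>ends l\<close> is the set of the two endpoints of the edge \<open>l\<close>.  Parallel edges are not excluded.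
\<close>

definition incident :: "('e \<Rightarrow> 'n set) \<Rightarrow> 'n \<Rightarrow> 'e set" where
  "incident ends i = {l. i \<in> ends l}"

text \<open>
  The signs in each column are arbitrary.  The predicate also says that every edge has exactly two
  endpoints, so there are no loops.
\<close>

definition incidence_matrix :: "('e::finite \<Rightarrow> 'n::finite set) \<Rightarrow> real^'e^'n \<Rightarrow> bool" where
  "incidence_matrix ends A \<longleftrightarrow>
     (\<forall>l. \<exists>i j. i \<noteq> j \<and> ends l = {i, j} \<and> A $ i $ l = 1 \<and> A $ j $ l = -1 \<and>
        (\<forall>v. v \<notin> ends l \<longrightarrow> A $ v $ l = 0))"

definition smooth_strongly_convex :: "real \<Rightarrow> real \<Rightarrow> (real \<Rightarrow> real) \<Rightarrow> bool" where
  "smooth_strongly_convex M \<mu> f \<longleftrightarrow>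
     0 < \<mu> \<and> \<mu> \<le> M \<and> (\<forall>x. f differentiable (at x)) \<and>
     (\<forall>x y. f x + deriv f x * (y - x) + \<mu> / 2 * (y - x)\<^sup>2 \<le> f y \<and>
            f y \<le> f x + deriv f x * (y - x) + M / 2 * (y - x)\<^sup>2)"

text \<open>The supremum is taken in the reals: it is finite whenever \<open>f\<close> is strongly convex.\<close>

definition fenchel_conjugate :: "(real \<Rightarrow> real) \<Rightarrow> real \<Rightarrow> real" where
  "fenchel_conjugate f y = (SUP x. y * x - f x)"

definition dual_objective ::
    "('n::finite \<Rightarrow> real \<Rightarrow> real) \<Rightarrow> real^'e::finite^'n \<Rightarrow> real^'e \<Rightarrow> real" where
  "dual_objective f A x = (\<Sum>i\<in>UNIV. fenchel_conjugate (f i) (axis i 1 \<bullet> (A *v x)))"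

definition partial_deriv :: "(real^'e::finite \<Rightarrow> real) \<Rightarrow> 'e \<Rightarrow> real^'e \<Rightarrow> real" where
  "partial_deriv F l x = deriv (\<lambda>t. F (x + t *\<^sub>R axis l 1)) 0"

definition gradient :: "(real^'e::finite \<Rightarrow> real) \<Rightarrow> real^'e \<Rightarrow> real^'e" where
  "gradient F x = (\<chi> l. partial_deriv F l x)"

definition coordinate_smooth ::
    "(real^'e::finite \<Rightarrow> real) \<Rightarrow> ('e \<Rightarrow> real) \<Rightarrow> bool" where
  "coordinate_smooth F L \<longleftrightarrow>
     (\<forall>l x \<alpha>. \<bar>partial_deriv F l (x + \<alpha> *\<^sub>R axis l 1) - partial_deriv F l x\<bar> \<le> L l * \<bar>\<alpha>\<bar>)"

definition eigenvalues :: "real^'m::finite^'m \<Rightarrow> real set" where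
  "eigenvalues B = {c. \<exists>v. v \<noteq> 0 \<and> B *v v = c *\<^sub>R v}"

definition gamma_min_pos :: "real^'e::finite^'n::finite \<Rightarrow> real" where
  "gamma_min_pos A = Min (eigenvalues (transpose A ** A) - {0})"

text \<open>The Moore--Penrose inverse: the unique solution of the four Penrose equations.\<close>

definition pseudo_inverse :: "real^'e::finite^'n::finite \<Rightarrow> real^'n^'e" where
  "pseudo_inverse A = (THE X. A ** X ** A = A \<and> X ** A ** X = X \<and>
     transpose (A ** X) = A ** X \<and> transpose (X ** A) = X ** A)"

definition seminorm_A :: "real^'e::finite^'n::finite \<Rightarrow> real^'e \<Rightarrow> real" where
  "seminorm_A A x = sqrt (x \<bullet> ((pseudo_inverse A ** A) *v x))"

definition node_weight :: "('e \<Rightarrow> 'n set) \<Rightarrow> ('e \<Rightarrow> real) \<Rightarrow> 'n \<Rightarrow> real" where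
  "node_weight ends L i = (\<Sum>m\<in>incident ends i. L m)"

definition edge_weight :: "('e \<Rightarrow> 'n set) \<Rightarrow> ('e \<Rightarrow> real) \<Rightarrow> 'e \<Rightarrow> real" where
  "edge_weight ends L l = (\<Sum>i\<in>ends l. 1 / node_weight ends L i)"

definition dual_norm_L ::
    "('e::finite \<Rightarrow> 'n set) \<Rightarrow> ('e \<Rightarrow> real) \<Rightarrow> real^'e \<Rightarrow> real" where
  "dual_norm_L ends L x = sqrt (\<Sum>l\<in>UNIV. 1 / edge_weight ends L l * (x $ l)\<^sup>2)"

text \<open>
  \<open>V\<close> is a set of admissible directions \<open>y - x\<close>.  For a seminorm whose kernel contains \<open>ker A\<close> one
  takes \<open>V = UNIV\<close>.  The objective is constant along \<open>ker A\<close>, which is non-trivial as soon as the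
  graph has a cycle; in a genuine norm it is then strongly convex only along
  \<open>(ker A)\<^sup>\<bottom> = range A\<^sup>T\<close>, and \<open>V\<close> is that subspace (all of the space if the graph is a forest).
\<close>

definition strongly_convex_along ::
    "(real^'e::finite \<Rightarrow> real) \<Rightarrow> (real^'e) set \<Rightarrow> (real^'e \<Rightarrow> real) \<Rightarrow> real \<Rightarrow> bool" where
  "strongly_convex_along F V N \<sigma> \<longleftrightarrow>
     (\<forall>x y. y - x \<in> V \<longrightarrow> F x + gradient F x \<bullet> (y - x) + \<sigma> / 2 * (N (y - x))\<^sup>2 \<le> F y)"

definition strong_convexity_constant ::
    "(real^'e::finite \<Rightarrow> real) \<Rightarrow> (real^'e) set \<Rightarrow> (real^'e \<Rightarrow> real) \<Rightarrow> real" where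
  "strong_convexity_constant F V N = Sup {\<sigma>. strongly_convex_along F V N \<sigma>}"

definition sigma_L ::
    "(real^'e::finite \<Rightarrow> real) \<Rightarrow> real^'e^'n::finite \<Rightarrow> ('e \<Rightarrow> 'n set) \<Rightarrow> ('e \<Rightarrow> real) \<Rightarrow> real" where
  "sigma_L F A ends L =
     strong_convexity_constant F (range (\<lambda>z. transpose A *v z)) (dual_norm_L ends L)"

definition sigma_A :: "(real^'e::finite \<Rightarrow> real) \<Rightarrow> real^'e^'n::finite \<Rightarrow> real" where
  "sigma_A F A = strong_convexity_constant F UNIV (seminorm_A A)"

text \<open>
  The spectral value of the strong convexity constant in the seminorm.  It is always a valid
  constant, but it need not be the largest one, which is \<open>sigma_A\<close>.
\<close>

definition sigma_A_spectral :: "real^'e::finite^'n::finite \<Rightarrow> ('n \<Rightarrow> real) \<Rightarrow> real" where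
  "sigma_A_spectral A M = gamma_min_pos A / Max (range M)"

text \<open>
  If \<open>L\<close> is positive and \<open>i\<close> is not isolated, the weights below are non-negative and sum to one,
  as \<open>embed_pmf\<close> requires.
\<close>

definition edge_pmf :: "('e \<Rightarrow> 'n set) \<Rightarrow> ('e \<Rightarrow> real) \<Rightarrow> 'n \<Rightarrow> 'e pmf" where
  "edge_pmf ends L i =
     embed_pmf (\<lambda>l. if l \<in> incident ends i then L l / (\<Sum>m\<in>incident ends i. L m) else 0)"

definition slcd_draw :: "('e \<Rightarrow> 'n::finite set) \<Rightarrow> ('e \<Rightarrow> real) \<Rightarrow> ('n \<times> 'e) pmf" where
  "slcd_draw ends L =
     bind_pmf (pmf_of_set UNIV) (\<lambda>i. map_pmf (\<lambda>l. (i, l)) (edge_pmf ends L i))"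

text \<open>
  In the process below \<open>node k\<close> and \<open>edge k\<close> are the node and the edge drawn at iteration \<open>k\<close>,
  \<open>X k\<close> is the \<open>k\<close>-th iterate and \<open>x0\<close> the (deterministic) starting point.  The law of a draw does
  not depend on the current iterate, so the draws of different iterations are i.i.d.
\<close>

definition slcd_process ::
    "'a measure \<Rightarrow> ('e::finite \<Rightarrow> 'n::finite set) \<Rightarrow> (real^'e \<Rightarrow> real) \<Rightarrow> ('e \<Rightarrow> real) \<Rightarrow> real^'e \<Rightarrow>
     (nat \<Rightarrow> 'a \<Rightarrow> 'n) \<Rightarrow> (nat \<Rightarrow> 'a \<Rightarrow> 'e) \<Rightarrow> (nat \<Rightarrow> 'a \<Rightarrow> real^'e) \<Rightarrow> bool" where
  "slcd_process P ends F L x0 node edge X \<longleftrightarrow>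
     prob_space P \<and>
     prob_space.indep_vars P (\<lambda>_. count_space UNIV) (\<lambda>k \<omega>. (node k \<omega>, edge k \<omega>)) UNIV \<and>
     (\<forall>k. distr P (count_space UNIV) (\<lambda>\<omega>. (node k \<omega>, edge k \<omega>)) = measure_pmf (slcd_draw ends L)) \<and>
     (\<forall>\<omega>\<in>space P. X 0 \<omega> = x0 \<and>
        (\<forall>k. X (Suc k) \<omega> =
           X k \<omega> - (1 / L (edge k \<omega>) * partial_deriv F (edge k \<omega>) (X k \<omega>)) *\<^sub>R axis (edge k \<omega>) 1))"

end

theory Submission
  imports Defs
begin

text \<open>
  Conjugation exchanges smoothness and strong convexity, so every \<open>f\<^sub>i\<^sup>*\<close> is differentiable and
  \<open>1/M\<^sub>i\<close>-strongly convex (\<open>smooth_strongly_convex_fenchel_conjugate\<close>).  The objective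
  \<open>F x = \<Sum>\<^sub>i f\<^sub>i\<^sup>* ((A x)\<^sub>i)\<close> depends on \<open>x\<close> only through \<open>A x\<close>, hence only through the orthogonal
  projection \<open>A\<^sup>+ A x\<close> of \<open>x\<close> onto the row space \<open>V = range A\<^sup>T\<close>, and its gradient lies in \<open>V\<close>.
  On \<open>V\<close> the seminorm \<open>\<parallel>_\<parallel>\<^sub>A\<close> is the Euclidean norm.

  \<^bold>\<open>The constants.\<close>  Summing the strong convexity of the \<open>f\<^sub>i\<^sup>*\<close> bounds \<open>F\<close> from below by its linear
  part plus \<open>\<parallel>A (y - x)\<parallel>\<^sup>2 / (2 M\<^sub>m\<^sub>a\<^sub>x)\<close>, and \<open>\<parallel>A v\<parallel>\<^sup>2\<close> is at least the smallest nonzero eigenvalue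
  of \<open>A\<^sup>T A\<close> times \<open>\<parallel>v\<parallel>\<^sup>2\<close> for \<open>v\<close> in \<open>V\<close> (\<open>gamma_min_pos_le\<close>); so the spectral value is an admissible
  strong convexity constant in \<open>\<parallel>_\<parallel>\<^sub>A\<close>.  The squared dual norm lies between the squared
  Euclidean norm divided by the largest and by the smallest edge weight.  A positive constant
  admissible for one of the two norms, scaled by the matching extreme edge weight, is therefore
  admissible for the other, and comparing the largest admissible constants
  gives both inequalities between \<open>\<sigma>\<^sub>A\<close> and \<open>\<sigma>\<^sub>L\<close> (\<open>strong_convexity_constant_comparison\<close>).

  \<^bold>\<open>The rate.\<close>  A step along edge \<open>l\<close> decreases \<open>F\<close> by at least \<open>(\<nabla>\<^sub>l F)\<^sup>2 / (2 L\<^sub>l)\<close>.  The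
  edge \<open>l\<close> is drawn from an endpoint \<open>i\<close> with probability \<open>L\<^sub>l / L\<^sup>i\<close>, where \<open>L\<^sup>i\<close> is the weight of
  the node, so the factors \<open>L\<^sub>l\<close> cancel in the mean and each edge is left with the weight
  \<open>\<Sum> 1 / L\<^sup>i\<close> over its two endpoints: the expected decrease is at least \<open>1/(2n)\<close> times the square
  of the weighted norm of the gradient (\<open>expected_decrease\<close>).  Minimising the strong convexity
  bound over the direction, which may be taken in \<open>V\<close>, shows that this square is at least
  \<open>2 \<sigma>\<^sub>L (F x - F y)\<close> for every \<open>y\<close> (\<open>gradient_dominance\<close>).

  \<^bold>\<open>Conditioning.\<close>  The \<open>k\<close>-th iterate is a function of the draws before \<open>k\<close>, so it takes finitely
  many values and is independent of the \<open>k\<close>-th draw.  The conditional expectation given the iterate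
  is then the mean over a fresh draw with the iterate frozen (\<open>real_cond_exp_indep_finite\<close>).
\<close>

section \<open>Conjugates of smooth strongly convex functions\<close>

lemma smooth_strongly_convex_imp_bounds:
  assumes "smooth_strongly_convex M \<mu> f"
  shows "0 < \<mu>" "0 < M" "(f has_real_derivative deriv f x) (at x)"
    "f x + deriv f x * (y - x) + \<mu> / 2 * (y - x)\<^sup>2 \<le> f y"
    "f y \<le> f x + deriv f x * (y - x) + M / 2 * (y - x)\<^sup>2"
  using assms unfolding smooth_strongly_convex_def
  by (auto simp: DERIV_deriv_iff_real_differentiable)

lemma quadratically_close_imp_DERIV:
  fixes h :: "real \<Rightarrow> real"
  assumes "\<And>z. \<bar>h z - h y - D * (z - y)\<bar> \<le> C * (z - y)\<^sup>2"
  shows "(h has_real_derivative D) (at y)"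
proof -
  have "(\<lambda>t. (h (y + t) - h y) / t - D) \<midarrow>0\<rightarrow> 0"
  proof (rule tendsto_0_le[where K = C])
    show "((\<lambda>t::real. t) \<longlongrightarrow> 0) (at 0)" by (rule tendsto_ident_at)
    have "norm ((h (y + t) - h y) / t - D) \<le> norm t * C" if "t \<noteq> 0" for t
    proof -
      have "\<bar>(h (y + t) - h y) / t - D\<bar> = \<bar>h (y + t) - h y - D * t\<bar> / \<bar>t\<bar>"
        using that by (simp add: abs_divide[symmetric] diff_divide_distrib)
      also have "\<dots> \<le> C * t\<^sup>2 / \<bar>t\<bar>"
        using assms[of "y + t"] by (intro divide_right_mono) auto
      also have "\<dots> = \<bar>t\<bar> * C"
        using that by (simp add: power2_eq_square field_simps abs_if)
      finally show ?thesis by simp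
    qed
    then show "\<forall>\<^sub>F t in at 0. norm ((h (y + t) - h y) / t - D) \<le> norm t * C"
      by (auto simp: eventually_at_filter)
  qed
  then show ?thesis
    unfolding DERIV_def by (rule LIM_zero_cancel)
qed

text \<open>
  The function \<open>\<lambda>t. f t - y * t\<close> grows quadratically, so it has a global minimum, and there its
  derivative \<open>deriv f p - y\<close> vanishes.
\<close>

lemma smooth_strongly_convex_deriv_surj:
  assumes "smooth_strongly_convex M \<mu> f"
  obtains p where "deriv f p = y"
proof -
  note f = smooth_strongly_convex_imp_bounds[OF assms]
  define q where "q t = f t - y * t" for t
  have cont: "continuous_on S q" for S
    unfolding q_def
    by (intro continuous_intros DERIV_continuous_on[OF DERIV_subset[OF f(3)]]) auto
  (* Beyond the radius R the term \<mu>/2 t^2 outweighs the slope of q at 0, so q t \<ge> q 0 there and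
     the minimum over the interval is global. *)
  define R where "R = 2 * \<bar>deriv f 0 - y\<bar> / \<mu> + 1"
  have R: "0 < R" using f(1) by (simp add: R_def add_nonneg_pos)
  obtain p where p: "p \<in> {-R..R}" "\<And>t. t \<in> {-R..R} \<Longrightarrow> q p \<le> q t"
    using continuous_attains_inf[OF compact_Icc _ cont, of "-R" R] R by auto
  have outside: "q 0 \<le> q t" if "t \<notin> {-R..R}" for t
  proof -
    have t: "R \<le> \<bar>t\<bar>" using that by auto
    have "\<bar>deriv f 0 - y\<bar> \<le> \<mu> / 2 * R" using f(1) by (simp add: R_def field_simps)
    also have "\<dots> \<le> \<mu> / 2 * \<bar>t\<bar>" using t f(1) by simp
    finally have "\<bar>deriv f 0 - y\<bar> * \<bar>t\<bar> \<le> \<mu> / 2 * \<bar>t\<bar> * \<bar>t\<bar>"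
      by (rule mult_right_mono) simp
    then have "- ((deriv f 0 - y) * t) \<le> \<mu> / 2 * t\<^sup>2"
      using abs_ge_minus_self[of "(deriv f 0 - y) * t"] by (simp add: abs_mult power2_eq_square)
    with f(4)[of 0 t] show ?thesis by (simp add: q_def algebra_simps)
  qed
  have pmin: "q p \<le> q t" for t
    using p(2)[of t] p(2)[of 0] outside[of t] R by fastforce
  have "(q has_real_derivative deriv f p - y) (at p)"
    unfolding q_def by (auto intro!: derivative_eq_intros f(3))
  from DERIV_local_min[OF this, of 1] pmin have "deriv f p - y = 0" by auto
  then show ?thesis using that by simp
qed

lemma fenchel_conjugate_eqI:
  assumes "\<And>x. y * x - f x \<le> y * p - f p"
  shows "fenchel_conjugate f y = y * p - f p"
  unfolding fenchel_conjugate_def using assms by (intro cSup_eq_maximum) auto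

text \<open>
  Let \<open>p y\<close> be a point with \<open>deriv f (p y) = y\<close>.  The supremum defining the conjugate at \<open>y\<close> is
  attained at \<open>p y\<close>, and \<open>p\<close> is the derivative of the conjugate.  The quadratic upper bound on \<open>f\<close>
  makes \<open>f\<close> small near \<open>p y\<close>, which bounds the conjugate from below; the quadratic lower bound on
  \<open>f\<close> bounds the conjugate from above.
\<close>

lemma smooth_strongly_convex_fenchel_conjugate:
  assumes "smooth_strongly_convex M \<mu> f"
  shows "smooth_strongly_convex (1 / \<mu>) (1 / M) (fenchel_conjugate f)"
proof -
  note f = smooth_strongly_convex_imp_bounds[OF assms]
  have "\<forall>y. \<exists>p. deriv f p = y"
    by (meson smooth_strongly_convex_deriv_surj[OF assms])
  then obtain p where p: "\<And>y. deriv f (p y) = y" by metis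
  have lower: "f (p y) + y * (x - p y) + \<mu> / 2 * (x - p y)\<^sup>2 \<le> f x" for x y
    using f(4)[of "p y" x] by (simp add: p)
  have upper: "f x \<le> f (p y) + y * (x - p y) + M / 2 * (x - p y)\<^sup>2" for x y
    using f(5)[of x "p y"] by (simp add: p)
  have young: "y * x - f x \<le> y * p y - f (p y)" for x y
  proof -
    have "0 \<le> \<mu> / 2 * (x - p y)\<^sup>2" using f(1) by simp
    with lower[where x=x and y=y] show ?thesis by (simp add: algebra_simps)
  qed
  then have conj: "fenchel_conjugate f y = y * p y - f (p y)" for y
    by (rule fenchel_conjugate_eqI)
  have lo: "fenchel_conjugate f y + p y * (z - y) + (1 / M) / 2 * (z - y)\<^sup>2
      \<le> fenchel_conjugate f z" for y z
  proof -
    (* Test the supremum at p y + (z - y) / M, which maximises z * x minus the upper bound on f x. *)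
    define D s where "D = (z - y) / M" and "s = (z - y)\<^sup>2 / (2 * M)"
    have "M / 2 * D\<^sup>2 = s" "(z - y) * D = 2 * s" "(1 / M) / 2 * (z - y)\<^sup>2 = s"
      using f(2) by (simp_all add: D_def s_def power2_eq_square)
    moreover have "f (p y + D) \<le> f (p y) + y * D + M / 2 * D\<^sup>2"
      using upper[of "p y + D" y] by simp
    moreover have "z * (p y + D) - f (p y + D) \<le> fenchel_conjugate f z"
      using young by (simp add: conj)
    ultimately show ?thesis by (simp add: conj algebra_simps)
  qed
  have up: "fenchel_conjugate f z
      \<le> fenchel_conjugate f y + p y * (z - y) + (1 / \<mu>) / 2 * (z - y)\<^sup>2" for y z
  proof -
    (* The bound is the maximum over d of (z - y) * d - \<mu>/2 d^2, obtained by completing the square. *)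
    define d where "d = p z - p y"
    have "0 \<le> \<mu> / 2 * (d - (z - y) / \<mu>)\<^sup>2" using f(1) by simp
    also have "\<dots> = \<mu> / 2 * d\<^sup>2 - (z - y) * d + (1 / \<mu>) / 2 * (z - y)\<^sup>2"
      using f(1) by (simp add: power2_eq_square field_simps)
    finally have "(z - y) * d - \<mu> / 2 * d\<^sup>2 \<le> (1 / \<mu>) / 2 * (z - y)\<^sup>2" by simp
    moreover have "f (p y) + y * d + \<mu> / 2 * d\<^sup>2 \<le> f (p z)"
      using lower[of y "p z"] by (simp add: d_def)
    ultimately show ?thesis by (simp add: conj d_def algebra_simps)
  qed
  have D: "(fenchel_conjugate f has_real_derivative p y) (at y)" for y
  proof (rule quadratically_close_imp_DERIV[where C = "(1 / \<mu>) / 2"])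
    fix z
    have "0 \<le> (1 / M) / 2 * (z - y)\<^sup>2" using f(2) by simp
    then have "0 \<le> fenchel_conjugate f z - fenchel_conjugate f y - p y * (z - y)"
      using lo[of y z] by linarith
    then show "\<bar>fenchel_conjugate f z - fenchel_conjugate f y - p y * (z - y)\<bar>
        \<le> (1 / \<mu>) / 2 * (z - y)\<^sup>2"
      using up[of z y] by simp
  qed
  have "fenchel_conjugate f differentiable at y" for y
    using D real_differentiable_def by blast
  moreover have "deriv (fenchel_conjugate f) = p"
    using DERIV_imp_deriv[OF D] by blast
  moreover have "0 < 1 / M" "1 / M \<le> 1 / \<mu>"
    using f(1,2) assms by (auto simp: smooth_strongly_convex_def frac_le)
  ultimately show ?thesis
    unfolding smooth_strongly_convex_def using lo up by blast
qed

section \<open>The gradient of the dual objective\<close>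

lemma dual_objective_eq:
  "dual_objective f A x = (\<Sum>i\<in>UNIV. fenchel_conjugate (f i) ((A *v x) $ i))"
  by (simp add: dual_objective_def inner_axis')

lemma DERIV_dual_objective_line:
  fixes A :: "real^'e::finite^'n::finite"
  assumes "\<And>i. smooth_strongly_convex (M i) (\<mu> i) (f i)"
  shows "((\<lambda>t. dual_objective f A (x + t *\<^sub>R d)) has_real_derivative
    (\<Sum>i\<in>UNIV. deriv (fenchel_conjugate (f i)) ((A *v (x + t *\<^sub>R d)) $ i) * (A *v d) $ i)) (at t)"
proof -
  note C = smooth_strongly_convex_fenchel_conjugate[OF assms]
  have "((\<lambda>t. (A *v (x + t *\<^sub>R d)) $ i) has_real_derivative (A *v d) $ i) (at t)" for i
    by (simp add: matrix_vector_right_distrib matrix_vector_mult_scaleR)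
       (auto intro!: derivative_eq_intros)
  then show ?thesis
    unfolding dual_objective_eq
    by (intro DERIV_sum DERIV_chain2[OF smooth_strongly_convex_imp_bounds(3)[OF C]])
qed

lemma matrix_vector_mult_component_sum_axis:
  fixes A :: "real^'e::finite^'n::finite"
  shows "(A *v d) $ i = (\<Sum>l\<in>UNIV. (A *v axis l 1) $ i * d $ l)"
  unfolding matrix_vector_mult_basis by (simp add: column_def matrix_vector_mult_def)

lemma gradient_dual_objective_inner:
  fixes A :: "real^'e::finite^'n::finite"
  assumes "\<And>i. smooth_strongly_convex (M i) (\<mu> i) (f i)"
  shows "gradient (dual_objective f A) x \<bullet> d
    = (\<Sum>i\<in>UNIV. deriv (fenchel_conjugate (f i)) ((A *v x) $ i) * (A *v d) $ i)"
proof -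
  have "partial_deriv (dual_objective f A) l x
      = (\<Sum>i\<in>UNIV. deriv (fenchel_conjugate (f i)) ((A *v x) $ i) * (A *v axis l 1) $ i)" for l
    unfolding partial_deriv_def
    using DERIV_imp_deriv[OF DERIV_dual_objective_line[OF assms,
          where A = A and x = x and d = "axis l 1" and t = 0]] by simp
  then have "gradient (dual_objective f A) x \<bullet> d
     = (\<Sum>l\<in>UNIV. (\<Sum>i\<in>UNIV. deriv (fenchel_conjugate (f i)) ((A *v x) $ i) *
          (A *v axis l 1) $ i) * d $ l)"
    by (simp add: gradient_def inner_vec_def)
  also have "\<dots> = (\<Sum>i\<in>UNIV. deriv (fenchel_conjugate (f i)) ((A *v x) $ i) *
      (\<Sum>l\<in>UNIV. (A *v axis l 1) $ i * d $ l))"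
    by (simp add: sum_distrib_left sum_distrib_right mult.assoc) (rule sum.swap)
  finally show ?thesis by (simp flip: matrix_vector_mult_component_sum_axis)
qed

lemma dual_objective_lower_quadratic:
  fixes A :: "real^'e::finite^'n::finite"
  assumes "\<And>i. smooth_strongly_convex (M i) (\<mu> i) (f i)"
  shows "dual_objective f A x + gradient (dual_objective f A) x \<bullet> (y - x)
      + (\<Sum>i\<in>UNIV. ((A *v (y - x)) $ i)\<^sup>2 / M i) / 2 \<le> dual_objective f A y"
proof -
  note C = smooth_strongly_convex_imp_bounds(4)[OF smooth_strongly_convex_fenchel_conjugate[OF assms]]
  have "dual_objective f A x + gradient (dual_objective f A) x \<bullet> (y - x)
      + (\<Sum>i\<in>UNIV. ((A *v (y - x)) $ i)\<^sup>2 / M i) / 2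
    = (\<Sum>i\<in>UNIV. fenchel_conjugate (f i) ((A *v x) $ i)
        + deriv (fenchel_conjugate (f i)) ((A *v x) $ i) * ((A *v y) $ i - (A *v x) $ i)
        + (1 / M i) / 2 * ((A *v y) $ i - (A *v x) $ i)\<^sup>2)"
    by (simp add: dual_objective_eq gradient_dual_objective_inner[OF assms] sum.distrib
        matrix_vector_mult_diff_distrib sum_divide_distrib)
  also have "\<dots> \<le> dual_objective f A y"
    unfolding dual_objective_eq by (intro sum_mono C)
  finally show ?thesis .
qed

lemma DERIV_dual_objective_coordinate:
  fixes A :: "real^'e::finite^'n::finite"
  assumes "\<And>i. smooth_strongly_convex (M i) (\<mu> i) (f i)"
  shows "((\<lambda>t. dual_objective f A (x + t *\<^sub>R axis l 1)) has_real_derivative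
    partial_deriv (dual_objective f A) l (x + t *\<^sub>R axis l 1)) (at t)"
proof -
  have "partial_deriv (dual_objective f A) l z = gradient (dual_objective f A) z \<bullet> axis l 1" for z
    by (simp add: gradient_def inner_axis)
  then show ?thesis
    using DERIV_dual_objective_line[OF assms, where A = A and x = x and d = "axis l 1" and t = t]
    by (simp add: gradient_dual_objective_inner[OF assms])
qed

text \<open>
  Strong convexity of the conjugates makes \<open>F\<close> strictly convex along any edge whose column is
  nonzero, so the partial derivative really moves and its Lipschitz constant cannot be zero.
\<close>

lemma coordinate_constant_pos:
  fixes A :: "real^'e::finite^'n::finite"
  assumes ssc: "\<And>i. smooth_strongly_convex (M i) (\<mu> i) (f i)"
    and cs: "coordinate_smooth (dual_objective f A) L"
    and col: "A $ i $ l \<noteq> 0"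
  shows "0 < L l"
proof -
  let ?F = "dual_objective f A" and ?e = "axis l 1 :: real^'e"
  let ?c = "\<Sum>i\<in>UNIV. ((A *v ?e) $ i)\<^sup>2 / M i"
  have M: "0 < M i" for i using smooth_strongly_convex_imp_bounds(2)[OF ssc] .
  have "0 < ((A *v ?e) $ i)\<^sup>2 / M i"
    using col M[of i] by (simp add: matrix_vector_mult_basis column_def)
  also have "\<dots> \<le> ?c"
    by (rule member_le_sum) (auto intro!: divide_nonneg_pos M)
  finally have "0 < ?c" .
  have neg: "(A *v (- ?e)) $ i = - (A *v ?e) $ i" for i
    using matrix_vector_mult_diff_distrib[of A 0 ?e] by simp
  (* Add the strong convexity bounds from 0 to e and from e to 0: the function values cancel. *)
  have "?c \<le> partial_deriv ?F l (0 + 1 *\<^sub>R ?e) - partial_deriv ?F l 0"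
    using dual_objective_lower_quadratic[where f = f and M = M and A = A and x = 0 and y = ?e, OF ssc]
      dual_objective_lower_quadratic[where f = f and M = M and A = A and x = ?e and y = 0, OF ssc]
    by (simp add: neg gradient_def inner_axis)
  also have "\<dots> \<le> L l"
    using cs[unfolded coordinate_smooth_def, rule_format, of l 0 1] by simp
  finally show ?thesis using \<open>0 < ?c\<close> by simp
qed

section \<open>Decrease in one coordinate step\<close>

lemma lipschitz_deriv_imp_upper_quadratic:
  fixes h h' :: "real \<Rightarrow> real"
  assumes D: "\<And>t. (h has_real_derivative h' t) (at t)"
    and lip: "\<And>t. \<bar>h' t - h' 0\<bar> \<le> C * \<bar>t\<bar>"
  shows "h t \<le> h 0 + h' 0 * t + C / 2 * t\<^sup>2"
proof -
  define q where "q t = h t - h' 0 * t - C / 2 * t\<^sup>2" for t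
  have Dq: "(q has_real_derivative (h' t - h' 0 - C * t)) (at t)" for t
    unfolding q_def by (auto intro!: derivative_eq_intros D)
  have "q t \<le> q 0"
  proof (cases "0 \<le> t")
    case True
    show ?thesis
    proof (rule DERIV_nonpos_imp_nonincreasing[OF True])
      fix s :: real assume "0 \<le> s"
      then show "\<exists>y. (q has_real_derivative y) (at s) \<and> y \<le> 0"
        using Dq[of s] lip[of s] by (intro exI conjI) auto
    qed
  next
    case False
    then have "t \<le> 0" by simp
    then show ?thesis
    proof (rule DERIV_nonneg_imp_nondecreasing)
      fix s :: real assume "s \<le> 0"
      then show "\<exists>y. (q has_real_derivative y) (at s) \<and> 0 \<le> y"
        using Dq[of s] lip[of s] by (intro exI conjI) auto
    qed
  qed
  then show ?thesis by (simp add: q_def)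
qed

lemma coordinate_step_decrease:
  fixes A :: "real^'e::finite^'n::finite"
  assumes ssc: "\<And>i. smooth_strongly_convex (M i) (\<mu> i) (f i)"
    and cs: "coordinate_smooth (dual_objective f A) L"
    and L: "0 < L l"
  shows "dual_objective f A (x - (1 / L l * partial_deriv (dual_objective f A) l x) *\<^sub>R axis l 1)
      \<le> dual_objective f A x - (partial_deriv (dual_objective f A) l x)\<^sup>2 / (2 * L l)"
proof -
  let ?F = "dual_objective f A"
  let ?g = "partial_deriv ?F l x"
  have "?F (x + (- ?g / L l) *\<^sub>R axis l 1)
      \<le> ?F (x + 0 *\<^sub>R axis l 1) + partial_deriv ?F l (x + 0 *\<^sub>R axis l 1) * (- ?g / L l)
        + L l / 2 * (- ?g / L l)\<^sup>2"
    by (rule lipschitz_deriv_imp_upper_quadratic[OF DERIV_dual_objective_coordinate[OF ssc]])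
      (use cs in \<open>auto simp: coordinate_smooth_def\<close>)
  then show ?thesis using L by (simp add: power2_eq_square field_simps)
qed

section \<open>The pseudo-inverse and the projection onto the row space\<close>

text \<open>
  The default rule rewrites \<open>transpose A *v z\<close> to \<open>z v* A\<close>, which would hide the adjoint that the
  arguments below move across inner products.
\<close>

declare transpose_matrix_vector [simp del]

abbreviation row_space :: "real^'e::finite^'n::finite \<Rightarrow> (real^'e) set" where
  "row_space A \<equiv> range (\<lambda>z. transpose A *v z)"

definition penrose_inverse :: "real^'e::finite^'n::finite \<Rightarrow> real^'n^'e \<Rightarrow> bool" where
  "penrose_inverse A X \<longleftrightarrow> A ** X ** A = A \<and> X ** A ** X = X \<and>
     transpose (A ** X) = A ** X \<and> transpose (X ** A) = X ** A"

lemma transpose_move_inner: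
  fixes A :: "real^'e::finite^'n::finite"
  shows "(transpose A *v z) \<bullet> x = z \<bullet> (A *v x)"
  by (metis dot_lmul_matrix inner_commute transpose_matrix_vector)

lemma subspace_row_space: "subspace (row_space (A :: real^'e::finite^'n::finite))"
  by (rule linear_subspace_image[OF matrix_vector_mul_linear subspace_UNIV])

text \<open>
  The row space is orthogonal to the kernel: a vector of the form \<open>transpose A *v z\<close> that \<open>A\<close> kills
  is orthogonal to itself.
\<close>

lemma row_space_kernel_trivial:
  fixes A :: "real^'e::finite^'n::finite"
  assumes "v \<in> row_space A" and "A *v v = 0"
  shows "v = 0"
proof -
  obtain z where "v = transpose A *v z" using assms(1) by auto
  then have "v \<bullet> v = 0" using assms(2) by (simp add: transpose_move_inner)
  then show ?thesis by simp
qed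

lemma gram_row_space_kernel_trivial:
  fixes A :: "real^'e::finite^'n::finite"
  assumes "v \<in> row_space A" and "transpose A *v (A *v v) = 0"
  shows "v = 0"
proof -
  have "(A *v v) \<bullet> (A *v v) = 0" using assms(2) transpose_move_inner[of A "A *v v" v] by simp
  then show ?thesis using row_space_kernel_trivial[OF assms(1)] by simp
qed

lemma symmetric_matrixI:
  fixes B :: "real^'n::finite^'n"
  assumes "\<And>x y. (B *v x) \<bullet> y = x \<bullet> (B *v y)"
  shows "transpose B = B"
proof -
  have "(transpose B *v x) \<bullet> z = (B *v x) \<bullet> z" for x z
    unfolding transpose_move_inner by (rule assms[symmetric])
  then show ?thesis
    unfolding matrix_eq by (blast intro: vector_eq_rdot[THEN iffD1])
qed

text \<open>
  The Gram matrix maps the row space into itself and is injective there, hence by dimension it is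
  a bijection of the row space.
\<close>

lemma gram_inverse_on_row_space:
  fixes A :: "real^'e::finite^'n::finite"
  obtains h where "linear h" "range h \<subseteq> row_space A"
    "\<And>v. v \<in> row_space A \<Longrightarrow> h (transpose A *v (A *v v)) = v"
    "\<And>v. v \<in> row_space A \<Longrightarrow> transpose A *v (A *v h v) = v"
proof -
  let ?G = "\<lambda>v. transpose A *v (A *v v)"
  have lin: "linear ?G"
    using linear_compose[OF matrix_vector_mul_linear matrix_vector_mul_linear]
    by (simp add: o_def)
  have inj: "inj_on ?G (row_space A)"
    using gram_row_space_kernel_trivial
    by (subst linear_inj_on_iff_eq_0[OF lin subspace_row_space]) blast
  obtain h where h: "range h \<subseteq> row_space A" "linear h" "\<And>v. v \<in> row_space A \<Longrightarrow> h (?G v) = v"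
    using linear_exists_left_inverse_on[OF lin subspace_row_space inj] by blast
  have sub: "?G ` row_space A \<subseteq> row_space A" by auto
  have "dim (?G ` row_space A) = dim (row_space A)"
    by (rule dim_image_eq[OF lin]) (use inj subspace_row_space span_eq_iff in metis)
  then have onto: "?G ` row_space A = row_space A"
    by (intro subspace_dim_equal[OF linear_subspace_image[OF lin subspace_row_space]
          subspace_row_space sub]) simp
  have "?G (h v) = v" if "v \<in> row_space A" for v
  proof -
    have "v \<in> ?G ` row_space A" using that by (simp only: onto)
    then obtain w where w: "w \<in> row_space A" "v = ?G w" by (rule imageE)
    show ?thesis unfolding w(2) h(3)[OF w(1)] ..
  qed
  then show ?thesis using that h by blast
qed

text \<open>
  With \<open>h\<close> the inverse of the Gram matrix on the row space, the matrix of \<open>z \<mapsto> h (transpose A *v z)\<close>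
  sends \<open>z\<close> to the least-squares solution of smallest norm, and this is the pseudo-inverse.  The
  normal equations \<open>GX\<close> are the source of all four Penrose equations.
\<close>

lemma penrose_inverse_exists:
  fixes A :: "real^'e::finite^'n::finite"
  shows "\<exists>X. penrose_inverse A X"
proof -
  obtain h where h: "linear h" "range h \<subseteq> row_space A"
    "\<And>v. v \<in> row_space A \<Longrightarrow> h (transpose A *v (A *v v)) = v"
    "\<And>v. v \<in> row_space A \<Longrightarrow> transpose A *v (A *v h v) = v"
    by (rule gram_inverse_on_row_space[of A]) blast
  define X where "X = matrix h ** transpose A"
  have X: "X *v z = h (transpose A *v z)" for z
    by (simp add: X_def matrix_of_matrix_vector_mul matrix_vector_mul_linear h(1) flip: matrix_vector_mul_assoc)
  have Xrow: "X *v z \<in> row_space A" for z using h(2) X by auto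
  have GX: "transpose A *v (A *v (X *v z)) = transpose A *v z" for z
    using h(4) X by auto
  have AXA: "A *v (X *v (A *v x)) = A *v x" for x
  proof -
    have "transpose A *v (A *v (X *v (A *v x) - x)) = 0"
      using GX[of "A *v x"] by (simp add: matrix_vector_mult_diff_distrib)
    then have "(A *v (X *v (A *v x) - x)) \<bullet> (A *v (X *v (A *v x) - x)) = 0"
      using transpose_move_inner by (metis inner_zero_left)
    then show ?thesis by (simp add: matrix_vector_mult_diff_distrib)
  qed
  have XA: "(X *v (A *v x)) \<bullet> v = x \<bullet> v" if "v \<in> row_space A" for x v
    using that AXA[of x] by (auto simp: inner_commute[of _ "transpose A *v _"] transpose_move_inner)
  have AX: "(A *v (X *v z)) \<bullet> (A *v x) = z \<bullet> (A *v x)" for z x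
    using GX[of z] by (metis transpose_move_inner)
  have AX_sym: "(A *v (X *v x)) \<bullet> y = x \<bullet> (A *v (X *v y))" for x y
    using AX[of x "X *v y"] AX[of y "X *v x"] by (simp add: inner_commute)
  have XA_sym: "(X *v (A *v x)) \<bullet> y = x \<bullet> (X *v (A *v y))" for x y
    using XA[OF Xrow[of "A *v y"], of x] XA[OF Xrow[of "A *v x"], of y] by (simp add: inner_commute)
  have XAX: "X *v (A *v (X *v z)) = X *v z" for z
    by (simp only: X[of "A *v (X *v z)"] GX) (simp only: X)
  have "penrose_inverse A X"
    unfolding penrose_inverse_def
  proof (intro conjI)
    show "A ** X ** A = A"
      by (simp add: matrix_eq AXA flip: matrix_vector_mul_assoc)
    show "X ** A ** X = X"
      using XAX by (simp add: matrix_eq flip: matrix_vector_mul_assoc)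
    show "transpose (A ** X) = A ** X"
      by (rule symmetric_matrixI) (use AX_sym in \<open>simp flip: matrix_vector_mul_assoc\<close>)
    show "transpose (X ** A) = X ** A"
      by (rule symmetric_matrixI) (use XA_sym in \<open>simp flip: matrix_vector_mul_assoc\<close>)
  qed
  then show ?thesis ..
qed

text \<open>
  The Penrose equations determine \<open>A ** X\<close> and \<open>X ** A\<close>, the orthogonal projections onto the column
  and the row space.  Replacing them one at a time in \<open>X ** A ** X\<close> turns it into \<open>Y ** A ** Y\<close>.
\<close>

lemma penrose_inverse_unique:
  fixes A :: "real^'e::finite^'n::finite"
  assumes "penrose_inverse A X" "penrose_inverse A Y"
  shows "X = Y"
proof -
  note X = assms(1)[unfolded penrose_inverse_def] and Y = assms(2)[unfolded penrose_inverse_def]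
  have "A ** X = A ** Y"
  proof -
    have "A ** X = transpose (A ** X)" using X by simp
    also have "\<dots> = transpose ((A ** Y) ** (A ** X))" using Y by (simp add: matrix_mul_assoc)
    also have "\<dots> = (A ** X) ** (A ** Y)" using X Y by (simp add: matrix_transpose_mul[of "A ** Y"])
    also have "\<dots> = A ** Y" using X by (simp add: matrix_mul_assoc)
    finally show ?thesis .
  qed
  moreover have "X ** A = Y ** A"
  proof -
    have "X ** A = transpose (X ** A)" using X by simp
    also have "\<dots> = transpose ((X ** A) ** (Y ** A))" using Y by (metis matrix_mul_assoc)
    also have "\<dots> = (Y ** A) ** (X ** A)" using X Y by (simp add: matrix_transpose_mul[of "X ** A"])
    also have "\<dots> = Y ** A" using X by (metis matrix_mul_assoc)
    finally show ?thesis .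
  qed
  ultimately show ?thesis using X Y by (metis matrix_mul_assoc)
qed

definition row_proj :: "real^'e::finite^'n::finite \<Rightarrow> real^'e \<Rightarrow> real^'e" where
  "row_proj A x = (pseudo_inverse A ** A) *v x"

lemma penrose_pseudo_inverse: "penrose_inverse A (pseudo_inverse A)"
proof -
  have "\<exists>!X. penrose_inverse A X"
    using penrose_inverse_exists penrose_inverse_unique by blast
  from theI'[OF this] show ?thesis
    unfolding pseudo_inverse_def penrose_inverse_def .
qed

text \<open>
  By the Penrose equations \<open>pseudo_inverse A ** A\<close> is symmetric and idempotent with range in the row
  space, so it is the orthogonal projection, and its quadratic form is the squared norm of the
  projection.
\<close>

lemma row_proj_properties:
  fixes A :: "real^'e::finite^'n::finite"
  shows row_proj_in: "row_proj A x \<in> row_space A"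
    and mult_row_proj: "A *v row_proj A x = A *v x"
    and row_proj_ident: "v \<in> row_space A \<Longrightarrow> row_proj A v = v"
    and seminorm_A_sq: "(seminorm_A A x)\<^sup>2 = (norm (row_proj A x))\<^sup>2"
proof -
  let ?X = "pseudo_inverse A"
  note X = penrose_pseudo_inverse[of A, unfolded penrose_inverse_def]
  have sym: "row_proj A u \<bullet> w = u \<bullet> row_proj A w" for u w
    unfolding row_proj_def using X by (metis transpose_move_inner)
  show inrow: "row_proj A x \<in> row_space A" for x
  proof -
    have "row_proj A x = transpose (?X ** A) *v x" using X by (simp add: row_proj_def)
    also have "\<dots> = transpose A *v (transpose ?X *v x)"
      by (simp add: matrix_transpose_mul matrix_vector_mul_assoc)
    finally show ?thesis by simp
  qed
  show A: "A *v row_proj A x = A *v x" for x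
    using X by (simp add: row_proj_def matrix_vector_mul_assoc matrix_mul_assoc)
  show id: "row_proj A v = v" if "v \<in> row_space A" for v
  proof -
    have "A *v (row_proj A v - v) = 0" by (simp add: A matrix_vector_mult_diff_distrib)
    moreover have "row_proj A v - v \<in> row_space A"
      by (intro subspace_diff subspace_row_space inrow that)
    ultimately show ?thesis using row_space_kernel_trivial by fastforce
  qed
  have "x \<bullet> row_proj A x = row_proj A x \<bullet> row_proj A x"
    using sym[of x "row_proj A x"] id[OF inrow] by (simp add: inner_commute)
  then show "(seminorm_A A x)\<^sup>2 = (norm (row_proj A x))\<^sup>2"
    unfolding seminorm_A_def row_proj_def[symmetric] by (simp add: power2_norm_eq_inner)
qed

section \<open>The smallest nonzero eigenvalue of the Gram matrix\<close>

text \<open>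
  Eigenvectors of a symmetric matrix for different eigenvalues are orthogonal, and an orthogonal
  family of nonzero vectors is independent, hence finite.
\<close>

lemma finite_eigenvalues_symmetric:
  fixes B :: "real^'m::finite^'m"
  assumes "transpose B = B"
  shows "finite (eigenvalues B)"
proof -
  define ev where "ev c = (SOME v. v \<noteq> 0 \<and> B *v v = c *\<^sub>R v)" for c
  have ev: "ev c \<noteq> 0" "B *v ev c = c *\<^sub>R ev c" if "c \<in> eigenvalues B" for c
    using that someI_ex[of "\<lambda>v. v \<noteq> 0 \<and> B *v v = c *\<^sub>R v"]
    unfolding ev_def eigenvalues_def by auto
  have orth: "ev c \<bullet> ev d = 0" if "c \<in> eigenvalues B" "d \<in> eigenvalues B" "c \<noteq> d" for c d
  proof -
    have "c * (ev c \<bullet> ev d) = d * (ev c \<bullet> ev d)"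
      using transpose_move_inner[of B "ev c" "ev d"] ev that assms by simp
    with that show ?thesis by simp
  qed
  have inj: "inj_on ev (eigenvalues B)"
    using orth ev by (intro inj_onI) (metis inner_eq_zero_iff)
  have "independent (ev ` eigenvalues B)"
    by (rule pairwise_orthogonal_independent)
      (use orth ev in \<open>auto simp: pairwise_def orthogonal_def\<close>)
  then have "finite (ev ` eigenvalues B)" by (rule independent_imp_finite)
  then show ?thesis using inj finite_imageD by blast
qed

lemma gram_eigenvalue_nonneg:
  fixes A :: "real^'e::finite^'n::finite"
  assumes "c \<in> eigenvalues (transpose A ** A)"
  shows "0 \<le> c"
proof -
  obtain v where v: "v \<noteq> 0" "transpose A *v (A *v v) = c *\<^sub>R v"
    using assms by (auto simp: eigenvalues_def matrix_vector_mul_assoc)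
  then have "(A *v v) \<bullet> (A *v v) = c * (v \<bullet> v)"
    using transpose_move_inner[of A "A *v v" v] by simp
  then show ?thesis
    using v(1) inner_ge_zero[of "A *v v"]
    by (metis inner_gt_zero_iff zero_le_mult_iff not_less)
qed

text \<open>
  Let \<open>v\<close> minimise \<open>\<parallel>A v\<parallel>\<^sup>2\<close> over the unit sphere of the row space, with minimum \<open>c\<close>.  The form
  \<open>\<parallel>A u\<parallel>\<^sup>2 - c \<parallel>u\<parallel>\<^sup>2\<close> is nonnegative on the row space and vanishes at \<open>v\<close>, so it is stationary
  there in every direction of the row space.  The residual \<open>r = A\<^sup>T A v - c v\<close> is such a direction,
  and the derivative along it is \<open>2 (r \<bullet> r)\<close>; so \<open>r = 0\<close>.
\<close>

lemma minimal_stretch_is_eigenvalue: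
  fixes A :: "real^'e::finite^'n::finite"
  assumes "row_space A \<noteq> {0}"
  obtains c where "c \<in> eigenvalues (transpose A ** A)" "c \<noteq> 0"
    "\<And>v. v \<in> row_space A \<Longrightarrow> c * (norm v)\<^sup>2 \<le> (norm (A *v v))\<^sup>2"
proof -
  let ?V = "row_space A"
  let ?S = "?V \<inter> sphere 0 1"
  obtain w where w: "w \<in> ?V" "w \<noteq> 0"
    using assms subspace_0[OF subspace_row_space[of A]] by blast
  have "(1 / norm w) *\<^sub>R w \<in> ?S"
    using w subspace_scale[OF subspace_row_space] by simp
  then have ne: "?S \<noteq> {}" by blast
  have comp: "compact ?S"
    by (intro closed_Int_compact closed_subspace subspace_row_space compact_sphere)
  have cont: "continuous_on ?S (\<lambda>v. (norm (A *v v))\<^sup>2)"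
    by (intro continuous_intros linear_continuous_on matrix_vector_mul_bounded_linear)
  obtain v where v: "v \<in> ?S" "\<And>u. u \<in> ?S \<Longrightarrow> (norm (A *v v))\<^sup>2 \<le> (norm (A *v u))\<^sup>2"
    using continuous_attains_inf[OF comp ne cont] by blast
  define c where "c = (norm (A *v v))\<^sup>2"
  have min: "c * (norm u)\<^sup>2 \<le> (norm (A *v u))\<^sup>2" if "u \<in> ?V" for u
  proof (cases "u = 0")
    case False
    have "(1 / norm u) *\<^sub>R u \<in> ?S"
      using that False subspace_scale[OF subspace_row_space] by simp
    from v(2)[OF this] show ?thesis
      using False by (simp add: c_def matrix_vector_mult_scaleR power_mult_distrib field_simps)
  qed simp
  have v1: "norm v = 1" "v \<in> ?V" "v \<noteq> 0" using v(1) by auto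
  define r where "r = transpose A *v (A *v v) - c *\<^sub>R v"
  have r: "r \<in> ?V"
    unfolding r_def
    by (intro subspace_diff subspace_scale subspace_row_space v1) auto
  have quad: "0 \<le> 2 * t * (r \<bullet> r) + t\<^sup>2 * ((norm (A *v r))\<^sup>2 - c * (norm r)\<^sup>2)" for t
  proof -
    have "v + t *\<^sub>R r \<in> ?V"
      by (intro subspace_add subspace_scale subspace_row_space v1 r)
    from min[OF this]
    have "c * ((v + t *\<^sub>R r) \<bullet> (v + t *\<^sub>R r)) \<le> (A *v v + t *\<^sub>R (A *v r)) \<bullet> (A *v v + t *\<^sub>R (A *v r))"
      by (simp add: power2_norm_eq_inner matrix_vector_right_distrib matrix_vector_mult_scaleR)
    moreover have "2 * t * (r \<bullet> r) = 2 * t * ((A *v v) \<bullet> (A *v r) - c * (v \<bullet> r))"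
      by (subst (1) r_def) (simp add: inner_diff_left transpose_move_inner)
    moreover have "v \<bullet> v = 1" "c = (A *v v) \<bullet> (A *v v)"
      using v1 by (simp_all add: norm_eq_1 c_def power2_norm_eq_inner)
    ultimately show ?thesis
      unfolding power2_norm_eq_inner
      by (simp add: inner_add_left inner_add_right inner_commute power2_eq_square algebra_simps)
  qed
  have "r \<bullet> r = 0"
  proof (rule ccontr)
    assume "r \<bullet> r \<noteq> 0"
    then have pos: "0 < r \<bullet> r" by simp
    define b where "b = (norm (A *v r))\<^sup>2 - c * (norm r)\<^sup>2"
    have b: "0 \<le> b" using min[OF r] by (simp add: b_def)
    (* With this small negative t the linear term of quad beats the quadratic one; the summand 1
       keeps the denominator positive when b = 0. *)
    define t where "t = - (r \<bullet> r) / (b + 1)"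
    have "t * (b + 1) = - (r \<bullet> r)" using b by (simp add: t_def)
    then have rr: "r \<bullet> r = - (t * (b + 1))" by linarith
    have "2 * t * (r \<bullet> r) + t\<^sup>2 * b = t * (r \<bullet> r) - t\<^sup>2"
      unfolding rr by (simp add: power2_eq_square algebra_simps)
    moreover have "t < 0" using b pos by (simp add: t_def divide_neg_pos)
    then have "t * (r \<bullet> r) < 0" using pos by (rule mult_neg_pos)
    ultimately show False using quad[of t] zero_le_power2[of t] unfolding b_def by linarith
  qed
  then have eig: "c \<in> eigenvalues (transpose A ** A)"
    using v1(3) by (auto simp: eigenvalues_def r_def matrix_vector_mul_assoc[symmetric])
  have "A *v v \<noteq> 0" using row_space_kernel_trivial v1 by blast
  then have "c \<noteq> 0" by (simp add: c_def)
  with eig min show ?thesis using that by blast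
qed

lemma gamma_min_pos_stretch:
  fixes A :: "real^'e::finite^'n::finite"
  assumes "row_space A \<noteq> {0}"
  shows gamma_min_pos_greater: "0 < gamma_min_pos A"
    and gamma_min_pos_le: "v \<in> row_space A \<Longrightarrow> gamma_min_pos A * (norm v)\<^sup>2 \<le> (norm (A *v v))\<^sup>2"
proof -
  let ?E = "eigenvalues (transpose A ** A) - {0}"
  have fin: "finite ?E"
    using finite_eigenvalues_symmetric[of "transpose A ** A"] by (simp add: matrix_transpose_mul)
  obtain c where c: "c \<in> ?E" "\<And>v. v \<in> row_space A \<Longrightarrow> c * (norm v)\<^sup>2 \<le> (norm (A *v v))\<^sup>2"
    using minimal_stretch_is_eigenvalue[OF assms] by blast
  have "gamma_min_pos A \<in> ?E"
    unfolding gamma_min_pos_def using fin c(1) by (intro Min_in) auto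
  then show "0 < gamma_min_pos A" using gram_eigenvalue_nonneg by fastforce
  have "gamma_min_pos A \<le> c" unfolding gamma_min_pos_def using fin c(1) by simp
  then show "gamma_min_pos A * (norm v)\<^sup>2 \<le> (norm (A *v v))\<^sup>2" if "v \<in> row_space A"
    using c(2)[OF that] by (meson mult_right_mono order_trans zero_le_power2)
qed

section \<open>Strong convexity in the two norms\<close>

lemma dual_objective_fibre:
  fixes A :: "real^'e::finite^'n::finite"
  assumes "A *v x = A *v y"
  shows "dual_objective f A x = dual_objective f A y"
  by (simp add: dual_objective_eq assms)

lemma dual_objective_add_row_proj:
  fixes A :: "real^'e::finite^'n::finite"
  shows "dual_objective f A (x + row_proj A (y - x)) = dual_objective f A y"
  by (rule dual_objective_fibre)
    (simp add: matrix_vector_right_distrib mult_row_proj matrix_vector_mult_diff_distrib)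

lemma gradient_dual_objective_row_proj:
  fixes A :: "real^'e::finite^'n::finite"
  assumes "\<And>i. smooth_strongly_convex (M i) (\<mu> i) (f i)"
  shows "gradient (dual_objective f A) x \<bullet> row_proj A d = gradient (dual_objective f A) x \<bullet> d"
  by (simp add: gradient_dual_objective_inner[OF assms] mult_row_proj)

text \<open>
  A single direction with \<open>N v \<noteq> 0\<close> bounds the admissible constants from above, so the
  supremum is not a default value; it is itself admissible because the inequality is closed in
  the constant.
\<close>

lemma strong_convexity_constant_Sup:
  assumes ne: "strongly_convex_along F V N \<sigma>0" and v: "v \<in> V" "N v \<noteq> 0"
  shows strong_convexity_constant_attained:
      "strongly_convex_along F V N (strong_convexity_constant F V N)"
    and strong_convexity_constant_upper:
      "strongly_convex_along F V N \<sigma> \<Longrightarrow> \<sigma> \<le> strong_convexity_constant F V N"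
proof -
  let ?S = "{\<sigma>. strongly_convex_along F V N \<sigma>}"
  let ?q = "\<lambda>x y. (F y - F x - gradient F x \<bullet> (y - x)) * 2 / (N (y - x))\<^sup>2"
  have q: "\<sigma> \<le> ?q x y" if "\<sigma> \<in> ?S" "y - x \<in> V" "N (y - x) \<noteq> 0" for \<sigma> x y
  proof -
    have "F x + gradient F x \<bullet> (y - x) + \<sigma> / 2 * (N (y - x))\<^sup>2 \<le> F y"
      using that(1,2) by (auto simp: strongly_convex_along_def)
    with that(3) show ?thesis by (simp add: field_simps)
  qed
  have bdd: "bdd_above ?S"
    using q[of _ v 0] v by (intro bdd_aboveI[of _ "?q 0 v"]) auto
  show upper: "\<sigma> \<le> strong_convexity_constant F V N" if "strongly_convex_along F V N \<sigma>" for \<sigma>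
    unfolding strong_convexity_constant_def using that bdd by (intro cSup_upper) auto
  show "strongly_convex_along F V N (strong_convexity_constant F V N)"
    unfolding strongly_convex_along_def
  proof (intro allI impI)
    fix x y assume xy: "y - x \<in> V"
    show "F x + gradient F x \<bullet> (y - x)
        + strong_convexity_constant F V N / 2 * (N (y - x))\<^sup>2 \<le> F y"
    proof (cases "N (y - x) = 0")
      case True
      then show ?thesis
        using ne[unfolded strongly_convex_along_def, rule_format, OF xy] by simp
    next
      case False
      have "strong_convexity_constant F V N \<le> ?q x y"
        unfolding strong_convexity_constant_def
        using ne q[OF _ xy False] by (intro cSup_least) auto
      with False show ?thesis by (simp add: field_simps)
    qed
  qed
qed

lemma dual_norm_L_sq:
  assumes "\<And>l. 0 < edge_weight ends L l"
  shows "(dual_norm_L ends L x)\<^sup>2 = (\<Sum>l\<in>UNIV. (x $ l)\<^sup>2 / edge_weight ends L l)"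
  unfolding dual_norm_L_def
  by (subst real_sqrt_pow2) (auto intro!: sum_nonneg simp: less_imp_le[OF assms])

lemma norm_vec_sq: "(norm (x :: real^'e::finite))\<^sup>2 = (\<Sum>l\<in>UNIV. (x $ l)\<^sup>2)"
  unfolding power2_norm_eq_inner by (simp add: inner_vec_def power2_eq_square)

lemma dual_norm_L_bounds:
  fixes ends :: "'e::finite \<Rightarrow> 'n set"
  assumes w: "\<And>l. 0 < edge_weight ends L l"
  shows Min_edge_weight_mult_dual_norm_L:
      "Min (range (edge_weight ends L)) * (dual_norm_L ends L x)\<^sup>2 \<le> (norm x)\<^sup>2"
    and norm_le_Max_edge_weight_mult_dual_norm_L:
      "(norm x)\<^sup>2 \<le> Max (range (edge_weight ends L)) * (dual_norm_L ends L x)\<^sup>2"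
proof -
  let ?w = "edge_weight ends L"
  have eq: "c * (dual_norm_L ends L x)\<^sup>2 = (\<Sum>l\<in>UNIV. c / ?w l * (x $ l)\<^sup>2)" for c
    by (simp add: dual_norm_L_sq[OF w] sum_distrib_left)
  have "Min (range ?w) / ?w l \<le> 1" "1 \<le> Max (range ?w) / ?w l" for l
    using w[of l] by simp_all
  then have "Min (range ?w) / ?w l * (x $ l)\<^sup>2 \<le> 1 * (x $ l)\<^sup>2"
    "1 * (x $ l)\<^sup>2 \<le> Max (range ?w) / ?w l * (x $ l)\<^sup>2" for l
    by (intro mult_right_mono; simp)+
  then show "Min (range ?w) * (dual_norm_L ends L x)\<^sup>2 \<le> (norm x)\<^sup>2"
    "(norm x)\<^sup>2 \<le> Max (range ?w) * (dual_norm_L ends L x)\<^sup>2"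
    unfolding eq norm_vec_sq by (simp_all add: sum_mono)
qed

lemma seminorm_A_spectral_strong_convexity:
  fixes A :: "real^'e::finite^'n::finite"
  assumes ssc: "\<And>i. smooth_strongly_convex (M i) (\<mu> i) (f i)" and ne: "row_space A \<noteq> {0}"
  shows "strongly_convex_along (dual_objective f A) UNIV (seminorm_A A) (sigma_A_spectral A M)"
  unfolding strongly_convex_along_def
proof (intro allI impI)
  fix x y :: "real^'e"
  let ?F = "dual_objective f A" and ?p = "row_proj A (y - x)" and ?Mx = "Max (range M)"
  have M: "0 < M i" "M i \<le> ?Mx" for i
    using smooth_strongly_convex_imp_bounds(2)[OF ssc] by auto
  have Mx: "0 < ?Mx" using M less_le_trans by blast
  have "sigma_A_spectral A M * (seminorm_A A (y - x))\<^sup>2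
      = gamma_min_pos A * (norm ?p)\<^sup>2 / ?Mx"
    by (simp add: sigma_A_spectral_def seminorm_A_sq)
  also have "\<dots> \<le> (norm (A *v ?p))\<^sup>2 / ?Mx"
    using gamma_min_pos_le[OF ne row_proj_in] Mx by (simp add: divide_right_mono)
  also have "\<dots> = (\<Sum>i\<in>UNIV. ((A *v (y - x)) $ i)\<^sup>2 / ?Mx)"
    by (simp only: mult_row_proj norm_vec_sq sum_divide_distrib)
  also have "\<dots> \<le> (\<Sum>i\<in>UNIV. ((A *v (y - x)) $ i)\<^sup>2 / M i)"
    using M by (intro sum_mono divide_left_mono) (auto intro: mult_pos_pos Mx)
  finally show "?F x + gradient ?F x \<bullet> (y - x)
      + sigma_A_spectral A M / 2 * (seminorm_A A (y - x))\<^sup>2 \<le> ?F y"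
    using dual_objective_lower_quadratic[where f = f and M = M and A = A and x = x and y = y, OF ssc] by simp
qed

lemma strong_convexity_seminorm_to_dual_norm:
  fixes A :: "real^'e::finite^'n::finite"
  assumes w: "\<And>l. 0 < edge_weight ends L l" and \<sigma>: "0 \<le> \<sigma>"
    and sc: "strongly_convex_along F UNIV (seminorm_A A) \<sigma>"
  shows "strongly_convex_along F (row_space A) (dual_norm_L ends L)
           (\<sigma> * Min (range (edge_weight ends L)))"
  unfolding strongly_convex_along_def
proof (intro allI impI)
  fix x y assume "y - x \<in> row_space A"
  then have "(seminorm_A A (y - x))\<^sup>2 = (norm (y - x))\<^sup>2"
    by (simp add: seminorm_A_sq row_proj_ident)
  then have "\<sigma> * (Min (range (edge_weight ends L)) * (dual_norm_L ends L (y - x))\<^sup>2)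
      \<le> \<sigma> * (seminorm_A A (y - x))\<^sup>2"
    using Min_edge_weight_mult_dual_norm_L[OF w, of "y - x"] \<sigma> by (simp add: mult_left_mono)
  moreover have "F x + gradient F x \<bullet> (y - x) + \<sigma> / 2 * (seminorm_A A (y - x))\<^sup>2 \<le> F y"
    using sc by (auto simp: strongly_convex_along_def)
  ultimately show "F x + gradient F x \<bullet> (y - x)
      + \<sigma> * Min (range (edge_weight ends L)) / 2 * (dual_norm_L ends L (y - x))\<^sup>2 \<le> F y"
    by (simp add: mult.assoc)
qed

text \<open>
  Strong convexity is known only for directions in the row space, but \<open>F\<close> and its linear part do
  not see the component of \<open>y - x\<close> in the kernel of \<open>A\<close>, and neither does the seminorm: it is enough
  to use the projected direction.
\<close>

lemma strong_convexity_dual_norm_to_seminorm: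
  fixes A :: "real^'e::finite^'n::finite"
  assumes ssc: "\<And>i. smooth_strongly_convex (M i) (\<mu> i) (f i)"
    and w: "\<And>l. 0 < edge_weight ends L l" and \<sigma>: "0 \<le> \<sigma>"
    and sc: "strongly_convex_along (dual_objective f A) (row_space A) (dual_norm_L ends L) \<sigma>"
  shows "strongly_convex_along (dual_objective f A) UNIV (seminorm_A A)
           (\<sigma> / Max (range (edge_weight ends L)))"
  unfolding strongly_convex_along_def
proof (intro allI impI)
  fix x y :: "real^'e"
  let ?F = "dual_objective f A" and ?p = "row_proj A (y - x)"
  let ?W = "Max (range (edge_weight ends L))"
  have "0 < ?W" using w by (metis Max_ge finite finite_imageI less_le_trans rangeI)
  then have "(norm ?p)\<^sup>2 / ?W \<le> (dual_norm_L ends L ?p)\<^sup>2"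
    using norm_le_Max_edge_weight_mult_dual_norm_L[OF w, of ?p] by (simp add: field_simps)
  then have "\<sigma> * ((norm ?p)\<^sup>2 / ?W) \<le> \<sigma> * (dual_norm_L ends L ?p)\<^sup>2"
    using \<sigma> by (rule mult_left_mono)
  moreover have "?F x + gradient ?F x \<bullet> ?p + \<sigma> / 2 * (dual_norm_L ends L ?p)\<^sup>2 \<le> ?F (x + ?p)"
    using sc row_proj_in[of A "y - x"]
    unfolding strongly_convex_along_def by (metis add_diff_cancel_left')
  ultimately show "?F x + gradient ?F x \<bullet> (y - x)
      + \<sigma> / ?W / 2 * (seminorm_A A (y - x))\<^sup>2 \<le> ?F y"
    by (simp add: dual_objective_add_row_proj gradient_dual_objective_row_proj[OF ssc] seminorm_A_sq)
qed

text \<open>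
  A Polyak-Lojasiewicz inequality.  Going from \<open>x\<close> in the direction of the projection of \<open>y - x\<close> onto
  the row space reaches the value \<open>F y\<close>, and the strong convexity bound along it can fall below \<open>F x\<close>
  by at most \<open>1/(2 \<sigma>)\<close> times the squared weighted norm of the gradient.
\<close>

lemma gradient_dominance:
  fixes A :: "real^'e::finite^'n::finite"
  assumes ssc: "\<And>i. smooth_strongly_convex (M i) (\<mu> i) (f i)"
    and w: "\<And>l. 0 < edge_weight ends L l" and \<sigma>: "0 < \<sigma>"
    and sc: "strongly_convex_along (dual_objective f A) (row_space A) (dual_norm_L ends L) \<sigma>"
  shows "2 * \<sigma> * (dual_objective f A x - dual_objective f A y)
    \<le> (\<Sum>l\<in>UNIV. edge_weight ends L l * (partial_deriv (dual_objective f A) l x)\<^sup>2)"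
proof -
  let ?F = "dual_objective f A" and ?w = "edge_weight ends L"
  define p where "p = row_proj A (y - x)"
  have "?F x + gradient ?F x \<bullet> p + \<sigma> / 2 * (dual_norm_L ends L p)\<^sup>2 \<le> ?F (x + p)"
    using sc row_proj_in[of A "y - x"]
    unfolding strongly_convex_along_def p_def by (metis add_diff_cancel_left')
  then have "?F x - ?F y \<le> - (gradient ?F x \<bullet> p) - \<sigma> / 2 * (dual_norm_L ends L p)\<^sup>2"
    by (simp add: p_def dual_objective_add_row_proj)
  also have "\<dots> = (\<Sum>l\<in>UNIV. - (partial_deriv ?F l x * p $ l) - \<sigma> / 2 * ((p $ l)\<^sup>2 / ?w l))"
    by (simp add: gradient_def inner_vec_def dual_norm_L_sq[OF w] sum_subtractf sum_negf
        sum_distrib_left)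
  also have "\<dots> \<le> (\<Sum>l\<in>UNIV. ?w l * (partial_deriv ?F l x)\<^sup>2 / (2 * \<sigma>))"
  proof (rule sum_mono)
    fix l
    (* Complete the square in p $ l, coordinate by coordinate. *)
    have "0 \<le> (?w l * partial_deriv ?F l x + \<sigma> * p $ l)\<^sup>2 / (2 * \<sigma> * ?w l)"
      using w[of l] \<sigma> by simp
    then show "- (partial_deriv ?F l x * p $ l) - \<sigma> / 2 * ((p $ l)\<^sup>2 / ?w l)
        \<le> ?w l * (partial_deriv ?F l x)\<^sup>2 / (2 * \<sigma>)"
      using w[of l] \<sigma> by (simp add: power2_eq_square field_simps)
  qed
  finally show ?thesis
    using \<sigma> by (simp add: field_simps flip: sum_divide_distrib)
qed

section \<open>Comparison of the strong convexity constants\<close>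

lemma node_weight_pos:
  fixes ends :: "'e::finite \<Rightarrow> 'n set"
  assumes "\<And>l. 0 < L l" "incident ends i \<noteq> {}"
  shows "0 < node_weight ends L i"
  unfolding node_weight_def using assms by (intro sum_pos) auto

lemma edge_weight_pos:
  fixes ends :: "'e::finite \<Rightarrow> 'n::finite set"
  assumes "\<And>l. 0 < L l" "ends l \<noteq> {}"
  shows "0 < edge_weight ends L l"
  unfolding edge_weight_def
  using assms by (intro sum_pos divide_pos_pos node_weight_pos) (auto simp: incident_def)

lemma incidence_matrix_column:
  assumes "incidence_matrix ends A"
  obtains i where "i \<in> ends l" "A $ i $ l = 1"
  using assms unfolding incidence_matrix_def by blast

lemma row_space_incidence_matrix:
  fixes A :: "real^'e::finite^'n::finite"
  assumes "incidence_matrix ends A"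
  shows "row_space A \<noteq> {0}"
proof -
  obtain i where i: "A $ i $ (undefined :: 'e) = 1" using incidence_matrix_column[OF assms] .
  have "(transpose A *v axis i 1) $ undefined = 1"
    using i by (simp add: matrix_vector_mult_basis column_def transpose_def)
  then have "transpose A *v axis i 1 \<noteq> 0" by (metis zero_index zero_neq_one)
  then show ?thesis by blast
qed

lemma strong_convexity_constant_comparison:
  fixes A :: "real^'e::finite^'n::finite"
  assumes ssc: "\<And>i. smooth_strongly_convex (M i) (\<mu> i) (f i)"
    and w: "\<And>l. 0 < edge_weight ends L l" and ne: "row_space A \<noteq> {0}"
  defines "F \<equiv> dual_objective f A" and "w \<equiv> edge_weight ends L"
  shows sigma_L_attained:
      "strongly_convex_along F (row_space A) (dual_norm_L ends L) (sigma_L F A ends L)"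
    and sigma_L_pos: "0 < sigma_L F A ends L"
    and sigma_A_spectral_le_sigma_A: "sigma_A_spectral A M \<le> sigma_A F A"
    and sigma_L_ge_spectral: "sigma_A_spectral A M * Min (range w) \<le> sigma_L F A ends L"
    and sigma_L_ge: "sigma_A F A * Min (range w) \<le> sigma_L F A ends L"
    and sigma_L_le: "sigma_L F A ends L \<le> sigma_A F A * Max (range w)"
proof -
  obtain v where v: "v \<in> row_space A" "v \<noteq> 0"
    using ne subspace_0[OF subspace_row_space[of A]] by blast
  have "(seminorm_A A v)\<^sup>2 \<noteq> 0" using v by (simp add: seminorm_A_sq row_proj_ident)
  then have Nv: "seminorm_A A v \<noteq> 0" by simp
  have Lv: "dual_norm_L ends L v \<noteq> 0"
    using norm_le_Max_edge_weight_mult_dual_norm_L[OF w, of v] v(2) by fastforce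
  have Mpos: "0 < M i" for i using smooth_strongly_convex_imp_bounds(2)[OF ssc] .
  have Mx: "0 < Max (range M)" using Mpos by (metis Max_ge finite finite_imageI less_le_trans rangeI)
  have Wmin: "0 < Min (range w)" using w by (simp add: w_def)
  have Wmax: "0 < Max (range w)"
    using w unfolding w_def by (metis Max_ge finite finite_imageI less_le_trans rangeI)
  have spec: "0 < sigma_A_spectral A M"
    using gamma_min_pos_greater[OF ne] Mx by (simp add: sigma_A_spectral_def)
  note scA = seminorm_A_spectral_strong_convexity[where f = f and M = M, OF ssc ne, folded F_def]
  note scL = strong_convexity_seminorm_to_dual_norm[OF w less_imp_le[OF spec] scA, folded w_def]
  note A = strong_convexity_constant_Sup[OF scA UNIV_I Nv, folded sigma_A_def]
  note L = strong_convexity_constant_Sup[OF scL v(1) Lv, folded sigma_L_def]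
  show "strongly_convex_along F (row_space A) (dual_norm_L ends L) (sigma_L F A ends L)"
    by (rule L(1))
  show a: "sigma_A_spectral A M \<le> sigma_A F A" by (rule A(2)[OF scA])
  show b: "sigma_A_spectral A M * Min (range w) \<le> sigma_L F A ends L" by (rule L(2)[OF scL])
  show pos: "0 < sigma_L F A ends L" using b spec Wmin by (smt (verit) mult_pos_pos)
  show "sigma_A F A * Min (range w) \<le> sigma_L F A ends L"
    using a spec
    by (intro L(2) strong_convexity_seminorm_to_dual_norm[OF w _ A(1), folded w_def]) simp
  have "sigma_L F A ends L / Max (range w) \<le> sigma_A F A"
    using L(1) unfolding F_def
    by (intro A(2)[unfolded F_def]
        strong_convexity_dual_norm_to_seminorm[where f = f,
          OF ssc w less_imp_le[OF pos[unfolded F_def]], folded w_def])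
  then show "sigma_L F A ends L \<le> sigma_A F A * Max (range w)"
    using Wmax by (simp add: field_simps)
qed

section \<open>Conditioning on an independent variable with finite range\<close>

lemma (in finite_measure) integrable_simple_function_real:
  fixes u :: "'a \<Rightarrow> real"
  assumes "simple_function M u"
  shows "integrable M u"
proof -
  have "finite (norm ` u ` space M)" using assms by (simp add: simple_functionD(1))
  then have "norm (u \<omega>) \<le> Max (norm ` u ` space M)" if "\<omega> \<in> space M" for \<omega>
    using that by (intro Max_ge) auto
  then show ?thesis
    by (intro integrable_const_bound[OF AE_I2] borel_measurable_simple_function assms)
qed

text \<open>
  Both variables take finitely many values, so a function of the pair splits into finitely many
  products \<open>q (Y \<omega>) z * indicator {z} (Z \<omega>)\<close> of independent factors.  Independence is stated
  through real-valued images of \<open>Y\<close> and \<open>Z\<close>, which gives the two variables a common value type.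
\<close>

lemma (in prob_space) expectation_indep_finite:
  fixes Y :: "'a \<Rightarrow> 'b" and Z :: "'a \<Rightarrow> 'c::finite" and q :: "'b \<Rightarrow> 'c \<Rightarrow> real"
  assumes Ym: "Y \<in> measurable M (count_space UNIV)" and Zm: "Z \<in> measurable M (count_space UNIV)"
    and ind: "\<And>(g :: 'b \<Rightarrow> real) (g' :: 'c \<Rightarrow> real). indep_var borel (\<lambda>\<omega>. g (Y \<omega>)) borel (\<lambda>\<omega>. g' (Z \<omega>))"
    and fin: "finite (Y ` space M)"
    and Z: "distr M (count_space UNIV) Z = measure_pmf D"
  shows "integrable M (\<lambda>\<omega>. q (Y \<omega>) (Z \<omega>))"
    and "expectation (\<lambda>\<omega>. q (Y \<omega>) (Z \<omega>)) = expectation (\<lambda>\<omega>. measure_pmf.expectation D (q (Y \<omega>)))"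
proof -
  have Ys: "simple_function M Y" using Ym fin by (simp add: simple_function_eq_measurable)
  have Zs: "simple_function M Z" using Zm by (simp add: simple_function_eq_measurable)
  have intY: "integrable M (\<lambda>\<omega>. g (Y \<omega>))" for g :: "'b \<Rightarrow> real"
    using integrable_simple_function_real[OF simple_function_compose[OF Ys, of g]] by (simp add: o_def)
  have intZ: "integrable M (\<lambda>\<omega>. g (Z \<omega>))" for g :: "'c \<Rightarrow> real"
    using integrable_simple_function_real[OF simple_function_compose[OF Zs, of g]] by (simp add: o_def)
  have pZ: "expectation (\<lambda>\<omega>. indicator {z} (Z \<omega>)) = pmf D z" for z
  proof -
    have "expectation (\<lambda>\<omega>. indicator {z} (Z \<omega>) :: real)
        = integral\<^sup>L (distr M (count_space UNIV) Z) (indicator {z})"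
      by (rule integral_distr[symmetric, OF Zm]) simp
    also have "\<dots> = pmf D z" by (simp add: Z pmf.rep_eq)
    finally show ?thesis .
  qed
  have split: "q (Y \<omega>) (Z \<omega>) = (\<Sum>z\<in>UNIV. q (Y \<omega>) z * indicator {z} (Z \<omega>))" for \<omega>
    by (simp add: indicator_def if_distrib[of "(*) _"] cong: if_cong)
  have indz: "indep_var borel (\<lambda>\<omega>. q (Y \<omega>) z) borel (\<lambda>\<omega>. indicator {z} (Z \<omega>) :: real)" for z
    by (rule ind)
  note prods = indep_var_lebesgue_integral[OF indz intY intZ] indep_var_integrable[OF indz intY intZ]
  show "integrable M (\<lambda>\<omega>. q (Y \<omega>) (Z \<omega>))"
    unfolding split by (intro Bochner_Integration.integrable_sum prods(2))
  have "expectation (\<lambda>\<omega>. q (Y \<omega>) (Z \<omega>))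
      = (\<Sum>z\<in>UNIV. expectation (\<lambda>\<omega>. q (Y \<omega>) z * indicator {z} (Z \<omega>)))"
    unfolding split by (intro Bochner_Integration.integral_sum prods(2))
  also have "\<dots> = (\<Sum>z\<in>UNIV. expectation (\<lambda>\<omega>. pmf D z * q (Y \<omega>) z))"
    by (simp add: prods(1) pZ mult.commute)
  also have "\<dots> = expectation (\<lambda>\<omega>. \<Sum>z\<in>UNIV. pmf D z * q (Y \<omega>) z)"
    by (intro Bochner_Integration.integral_sum[symmetric] intY)
  also have "\<dots> = expectation (\<lambda>\<omega>. measure_pmf.expectation D (q (Y \<omega>)))"
    by (subst integral_measure_pmf[of UNIV]) simp_all
  finally show "expectation (\<lambda>\<omega>. q (Y \<omega>) (Z \<omega>)) = expectation (\<lambda>\<omega>. measure_pmf.expectation D (q (Y \<omega>)))" .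
qed

text \<open>
  An event generated by \<open>Y\<close> is an indicator of \<open>Y\<close>, which can be absorbed into the function of
  \<open>(Y, Z)\<close>; the defining property of the conditional expectation is then the preceding lemma.
  Finiteness of the range makes every function of \<open>Y\<close> measurable, so \<open>h\<close> may be arbitrary.
\<close>

lemma (in prob_space) real_cond_exp_indep_finite:
  fixes Y :: "'a \<Rightarrow> 'b::t2_space" and Z :: "'a \<Rightarrow> 'c::finite" and h :: "'b \<Rightarrow> 'c \<Rightarrow> real"
  assumes Ym: "Y \<in> measurable M (count_space UNIV)" and Zm: "Z \<in> measurable M (count_space UNIV)"
    and ind: "\<And>(g :: 'b \<Rightarrow> real) (g' :: 'c \<Rightarrow> real). indep_var borel (\<lambda>\<omega>. g (Y \<omega>)) borel (\<lambda>\<omega>. g' (Z \<omega>))"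
    and fin: "finite (Y ` space M)"
    and Z: "distr M (count_space UNIV) Z = measure_pmf D"
    and U: "\<And>\<omega>. \<omega> \<in> space M \<Longrightarrow> U \<omega> = h (Y \<omega>) (Z \<omega>)"
  shows "AE \<omega> in M. real_cond_exp M (vimage_algebra (space M) Y borel) U \<omega>
    = measure_pmf.expectation D (h (Y \<omega>))"
proof -
  let ?G = "vimage_algebra (space M) Y borel"
  have Yb: "Y \<in> borel_measurable M"
    using measurable_compose[OF Ym, of "\<lambda>y. y" borel] by simp
  have sub: "subalgebra M ?G"
    unfolding subalgebra_def
    using Yb by (auto simp: sets_vimage_algebra2 intro: measurable_sets)
  interpret G: finite_measure_subalgebra M ?G
    by (intro finite_measure_subalgebra.intro finite_measure_subalgebra_axioms.intro
        finite_measure_axioms sub)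
  have YG: "Y \<in> borel_measurable ?G" by (rule measurable_vimage_algebra1) simp
  then have "simple_function ?G Y" using fin by (intro simple_function_borel_measurable) simp_all
  then have simpleG: "simple_function ?G (\<lambda>\<omega>. measure_pmf.expectation D (h (Y \<omega>)))"
    using simple_function_compose[of ?G Y "\<lambda>y. measure_pmf.expectation D (h y)"] by (simp add: o_def)
  show ?thesis
  proof (rule G.real_cond_exp_charact)
    fix B assume "B \<in> sets ?G"
    then obtain C where C: "B = Y -` C \<inter> space M" by (auto simp: sets_vimage_algebra2)
    have "(\<integral>\<omega>\<in>B. U \<omega> \<partial>M) = expectation (\<lambda>\<omega>. indicator C (Y \<omega>) * h (Y \<omega>) (Z \<omega>))"
      unfolding set_lebesgue_integral_def
      by (intro Bochner_Integration.integral_cong) (auto simp: C U indicator_def)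
    also have "\<dots> = expectation (\<lambda>\<omega>. measure_pmf.expectation D (\<lambda>z. indicator C (Y \<omega>) * h (Y \<omega>) z))"
      by (rule expectation_indep_finite(2)[OF Ym Zm ind fin Z])
    also have "\<dots> = (\<integral>\<omega>\<in>B. measure_pmf.expectation D (h (Y \<omega>)) \<partial>M)"
      unfolding set_lebesgue_integral_def
      by (intro Bochner_Integration.integral_cong) (auto simp: C indicator_def)
    finally show "(\<integral>\<omega>\<in>B. U \<omega> \<partial>M) = (\<integral>\<omega>\<in>B. measure_pmf.expectation D (h (Y \<omega>)) \<partial>M)" .
  next
    show "integrable M U"
      using expectation_indep_finite(1)[OF Ym Zm ind fin Z, of h]
      by (subst Bochner_Integration.integrable_cong[OF refl U]) simp_all
    show "(\<lambda>\<omega>. measure_pmf.expectation D (h (Y \<omega>))) \<in> borel_measurable ?G"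
      by (rule borel_measurable_simple_function[OF simpleG])
    then have "(\<lambda>\<omega>. measure_pmf.expectation D (h (Y \<omega>))) \<in> borel_measurable M"
      by (rule measurable_from_subalg[OF sub])
    moreover have "finite ((\<lambda>\<omega>. measure_pmf.expectation D (h (Y \<omega>))) ` space M)"
      using finite_imageI[OF fin, of "\<lambda>y. measure_pmf.expectation D (h y)"] by (simp add: image_image)
    ultimately show "integrable M (\<lambda>\<omega>. measure_pmf.expectation D (h (Y \<omega>)))"
      by (intro integrable_simple_function_real simple_function_borel_measurable)
  qed
qed

section \<open>The process and its past\<close>

definition coordinate_step ::
    "(real^'e::finite \<Rightarrow> real) \<Rightarrow> ('e \<Rightarrow> real) \<Rightarrow> 'e \<Rightarrow> real^'e \<Rightarrow> real^'e" where
  "coordinate_step F L l x = x - (1 / L l * partial_deriv F l x) *\<^sub>R axis l 1"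

text \<open>
  The iterates as a function of the whole sequence of drawn edges, so that dependence on the
  first \<open>k\<close> draws alone can be stated.
\<close>

primrec descent_path ::
    "(real^'e::finite \<Rightarrow> real) \<Rightarrow> ('e \<Rightarrow> real) \<Rightarrow> real^'e \<Rightarrow> (nat \<Rightarrow> 'e) \<Rightarrow> nat \<Rightarrow> real^'e" where
  "descent_path F L x0 e 0 = x0"
| "descent_path F L x0 e (Suc k) = coordinate_step F L (e k) (descent_path F L x0 e k)"

lemma descent_path_cong:
  "(\<And>j. j < k \<Longrightarrow> e j = e' j) \<Longrightarrow> descent_path F L x0 e k = descent_path F L x0 e' k"
  by (induction k) simp_all

lemma slcd_process_iterate:
  assumes "slcd_process P ends F L x0 node edge X" "\<omega> \<in> space P"
  shows "X (Suc k) \<omega> = coordinate_step F L (edge k \<omega>) (X k \<omega>)"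
    and "X k \<omega> = descent_path F L x0 (\<lambda>j. edge j \<omega>) k"
proof -
  have X: "X 0 \<omega> = x0" "X (Suc k) \<omega> = coordinate_step F L (edge k \<omega>) (X k \<omega>)" for k
    using assms unfolding slcd_process_def coordinate_step_def by auto
  show "X (Suc k) \<omega> = coordinate_step F L (edge k \<omega>) (X k \<omega>)" by (rule X)
  show "X k \<omega> = descent_path F L x0 (\<lambda>j. edge j \<omega>) k" by (induction k) (simp_all add: X)
qed

text \<open>
  The \<open>k\<close>-th iterate factors through the restriction of the draws to \<open>{..<k}\<close>, which takes finitely
  many values and is independent of the restriction to \<open>{k}\<close>.
\<close>

lemma slcd_process_past:
  fixes node :: "nat \<Rightarrow> 'a \<Rightarrow> 'n::finite" and edge :: "nat \<Rightarrow> 'a \<Rightarrow> 'e::finite"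
    and g :: "real^'e \<Rightarrow> real" and g' :: "'n \<times> 'e \<Rightarrow> real"
  assumes "slcd_process P ends F L x0 node edge X"
  shows "X k \<in> measurable P (count_space UNIV)"
    and "(\<lambda>\<omega>. (node k \<omega>, edge k \<omega>)) \<in> measurable P (count_space UNIV)"
    and "prob_space.indep_var P borel (\<lambda>\<omega>. g (X k \<omega>)) borel (\<lambda>\<omega>. g' (node k \<omega>, edge k \<omega>))"
    and "finite (X k ` space P)"
proof -
  interpret prob_space P using assms by (simp add: slcd_process_def)
  let ?D = "\<lambda>j \<omega>. (node j \<omega>, edge j \<omega>)"
  let ?past = "\<lambda>\<omega>. restrict (\<lambda>j. ?D j \<omega>) {..<k}" and ?now = "\<lambda>\<omega>. restrict (\<lambda>j. ?D j \<omega>) {k}"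
  let ?\<Phi> = "\<lambda>d :: nat \<Rightarrow> 'n \<times> 'e. descent_path F L x0 (\<lambda>j. snd (d j)) k"
  have X: "X k \<omega> = ?\<Phi> (?past \<omega>)" if "\<omega> \<in> space P" for \<omega>
    unfolding slcd_process_iterate(2)[OF assms that] by (rule descent_path_cong) simp
  have "X k ` space P \<subseteq> ?\<Phi> ` (PiE {..<k} (\<lambda>_. UNIV))"
    unfolding image_subset_iff
  proof
    fix \<omega> assume "\<omega> \<in> space P"
    moreover have "?past \<omega> \<in> PiE {..<k} (\<lambda>_. UNIV)" by simp
    ultimately show "X k \<omega> \<in> ?\<Phi> ` (PiE {..<k} (\<lambda>_. UNIV))" using X by (blast intro: image_eqI)
  qed
  then show "finite (X k ` space P)" by (rule finite_subset) (simp add: finite_PiE)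
  have D: "indep_vars (\<lambda>_. count_space UNIV) ?D UNIV" using assms by (simp add: slcd_process_def)
  then show "?D k \<in> measurable P (count_space UNIV)" by (simp add: indep_vars_def)
  have ind: "indep_var (PiM {..<k} (\<lambda>_. count_space UNIV)) ?past (PiM {k} (\<lambda>_. count_space UNIV)) ?now"
    by (rule indep_var_restrict[OF D]) auto
  have past: "PiM {..<k} (\<lambda>_. count_space (UNIV :: ('n \<times> 'e) set)) = count_space (PiE {..<k} (\<lambda>_. UNIV))"
    by (rule count_space_PiM_finite) auto
  have "(\<lambda>\<omega>. ?\<Phi> (?past \<omega>)) \<in> measurable P (count_space UNIV)"
    by (rule measurable_compose[OF indep_var_rv1[OF ind]]) (simp add: past)
  then show "X k \<in> measurable P (count_space UNIV)"
    using X by (subst measurable_cong) auto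
  have "g \<circ> ?\<Phi> \<in> borel_measurable (PiM {..<k} (\<lambda>_. count_space UNIV))" by (simp add: past)
  moreover have "(\<lambda>d. g' (d k)) \<in> borel_measurable (PiM {k} (\<lambda>_. count_space UNIV))"
    by (rule measurable_compose[OF measurable_component_singleton]) simp_all
  ultimately have "indep_var borel ((g \<circ> ?\<Phi>) \<circ> ?past) borel ((\<lambda>d. g' (d k)) \<circ> ?now)"
    by (rule indep_var_compose[OF ind])
  then have "indep_var borel (\<lambda>\<omega>. g (?\<Phi> (?past \<omega>))) borel (\<lambda>\<omega>. g' (?D k \<omega>))"
    by (simp add: o_def)
  moreover have "indep_var borel (\<lambda>\<omega>. g (?\<Phi> (?past \<omega>))) borel (\<lambda>\<omega>. g' (?D k \<omega>))
      \<longleftrightarrow> indep_var borel (\<lambda>\<omega>. g (X k \<omega>)) borel (\<lambda>\<omega>. g' (?D k \<omega>))"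
    unfolding indep_var_distribution_eq
    by (intro conj_cong arg_cong2[of _ _ _ _ "(=)"] arg_cong2[of _ _ _ _ pair_measure] distr_cong
        measurable_cong refl) (simp_all add: X)
  ultimately show "indep_var borel (\<lambda>\<omega>. g (X k \<omega>)) borel (\<lambda>\<omega>. g' (?D k \<omega>))" by blast
qed

section \<open>The mean over one draw\<close>

lemma pmf_edge_pmf:
  fixes ends :: "'e::finite \<Rightarrow> 'n set"
  assumes L: "\<And>l. 0 < L l" and i: "incident ends i \<noteq> {}"
  shows "pmf (edge_pmf ends L i) l = (if l \<in> incident ends i then L l / node_weight ends L i else 0)"
proof -
  let ?p = "\<lambda>l. if l \<in> incident ends i then L l / node_weight ends L i else 0"
  have nw: "0 < node_weight ends L i" using node_weight_pos[of L ends i] assms by blast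
  have nonneg: "0 \<le> ?p l" for l using nw L[of l] by simp
  have "(\<Sum>l\<in>UNIV. ?p l) = (\<Sum>l\<in>incident ends i. L l / node_weight ends L i)"
    by (simp add: sum.If_cases)
  also have "\<dots> = 1" using nw by (simp add: node_weight_def flip: sum_divide_distrib)
  finally have "(\<integral>\<^sup>+l. ennreal (?p l) \<partial>count_space UNIV) = 1"
    using nonneg by (simp add: nn_integral_count_space_finite sum_ennreal)
  then show ?thesis
    unfolding edge_pmf_def node_weight_def[symmetric]
    by (rule pmf_embed_pmf[OF nonneg])
qed

text \<open>
  Node \<open>i\<close> and then edge \<open>l\<close> are drawn with probability \<open>L l / (n * node_weight ends L i)\<close>.
  Exchanging the two sums collects, for each edge, the two reciprocal node weights of its ends.
\<close>

lemma expectation_slcd_draw: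
  fixes ends :: "'e::finite \<Rightarrow> 'n::finite set"
  assumes L: "\<And>l. 0 < L l" and i: "\<And>i. incident ends i \<noteq> {}"
  shows "measure_pmf.expectation (slcd_draw ends L) (\<lambda>z. g (snd z))
    = (\<Sum>l\<in>UNIV. edge_weight ends L l * (L l * g l)) / real CARD('n)"
proof -
  have "measure_pmf.expectation (slcd_draw ends L) (\<lambda>z. g (snd z))
      = (\<Sum>i\<in>UNIV. measure_pmf.expectation (edge_pmf ends L i) g / real CARD('n))"
    unfolding slcd_draw_def
    by (subst pmf_expectation_bind_pmf_of_set) (auto simp: divide_inverse mult.commute)
  also have "\<dots> = (\<Sum>i\<in>UNIV. \<Sum>l\<in>UNIV. if i \<in> ends l then L l * g l / node_weight ends L i else 0) / real CARD('n)"
    by (subst integral_measure_pmf[of UNIV])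
      (auto simp: sum_divide_distrib pmf_edge_pmf[OF L i] incident_def intro!: sum.cong)
  also have "(\<Sum>i\<in>UNIV. \<Sum>l\<in>UNIV. if i \<in> ends l then L l * g l / node_weight ends L i else 0)
      = (\<Sum>l\<in>UNIV. \<Sum>i\<in>UNIV. if i \<in> ends l then L l * g l / node_weight ends L i else 0)"
    by (rule sum.swap)
  also have "\<dots> = (\<Sum>l\<in>UNIV. edge_weight ends L l * (L l * g l))"
    by (simp add: sum.If_cases edge_weight_def sum_distrib_right)
  finally show ?thesis .
qed

lemma expected_decrease:
  fixes A :: "real^'e::finite^'n::finite" and ends :: "'e \<Rightarrow> 'n set"
  assumes ssc: "\<And>i. smooth_strongly_convex (M i) (\<mu> i) (f i)"
    and cs: "coordinate_smooth (dual_objective f A) L"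
    and L: "\<And>l. 0 < L l" and i: "\<And>i. incident ends i \<noteq> {}"
  shows "measure_pmf.expectation (slcd_draw ends L)
      (\<lambda>z. dual_objective f A (coordinate_step (dual_objective f A) L (snd z) x))
    \<le> dual_objective f A x
      - (\<Sum>l\<in>UNIV. edge_weight ends L l * (partial_deriv (dual_objective f A) l x)\<^sup>2) / (2 * real CARD('n))"
proof -
  let ?F = "dual_objective f A" and ?D = "measure_pmf (slcd_draw ends L)"
  let ?g = "\<lambda>l. (partial_deriv ?F l x)\<^sup>2 / (2 * L l)"
  have int: "integrable ?D u" for u :: "'n \<times> 'e \<Rightarrow> real" by (rule integrable_measure_pmf_finite) simp
  have "measure_pmf.expectation (slcd_draw ends L) (\<lambda>z. ?F (coordinate_step ?F L (snd z) x))
      \<le> measure_pmf.expectation (slcd_draw ends L) (\<lambda>z. ?F x - ?g (snd z))"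
    unfolding coordinate_step_def
    by (intro integral_mono int coordinate_step_decrease[OF ssc cs L])
  also have "\<dots> = ?F x - measure_pmf.expectation (slcd_draw ends L) (\<lambda>z. ?g (snd z))"
    by (simp add: Bochner_Integration.integral_diff int)
  also have "measure_pmf.expectation (slcd_draw ends L) (\<lambda>z. ?g (snd z))
      = (\<Sum>l\<in>UNIV. edge_weight ends L l * (L l * ?g l)) / real CARD('n)"
    by (rule expectation_slcd_draw[OF L i])
  also have "(\<lambda>l. edge_weight ends L l * (L l * ?g l))
      = (\<lambda>l. edge_weight ends L l * (partial_deriv ?F l x)\<^sup>2 / 2)"
    using L by (auto simp: fun_eq_iff less_imp_neq[THEN not_sym])
  finally show ?thesis by (simp flip: sum_divide_distrib)
qed

lemma expected_contraction:
  fixes A :: "real^'e::finite^'n::finite" and ends :: "'e \<Rightarrow> 'n set"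
  assumes ssc: "\<And>i. smooth_strongly_convex (M i) (\<mu> i) (f i)"
    and cs: "coordinate_smooth (dual_objective f A) L"
    and L: "\<And>l. 0 < L l" and i: "\<And>i. incident ends i \<noteq> {}"
    and w: "\<And>l. 0 < edge_weight ends L l" and \<sigma>: "0 < \<sigma>"
    and sc: "strongly_convex_along (dual_objective f A) (row_space A) (dual_norm_L ends L) \<sigma>"
  shows "measure_pmf.expectation (slcd_draw ends L)
      (\<lambda>z. dual_objective f A (coordinate_step (dual_objective f A) L (snd z) x)) - dual_objective f A y
    \<le> (1 - \<sigma> / real CARD('n)) * (dual_objective f A x - dual_objective f A y)"
proof -
  let ?F = "dual_objective f A"
  have "2 * \<sigma> * (?F x - ?F y) / (2 * real CARD('n))
      \<le> (\<Sum>l\<in>UNIV. edge_weight ends L l * (partial_deriv ?F l x)\<^sup>2) / (2 * real CARD('n))"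
    by (intro divide_right_mono gradient_dominance[OF ssc w \<sigma> sc]) simp
  moreover have "2 * \<sigma> * (?F x - ?F y) / (2 * real CARD('n)) = \<sigma> / real CARD('n) * (?F x - ?F y)"
    by simp
  ultimately have "measure_pmf.expectation (slcd_draw ends L) (\<lambda>z. ?F (coordinate_step ?F L (snd z) x))
      \<le> ?F x - \<sigma> / real CARD('n) * (?F x - ?F y)"
    using expected_decrease[where f = f and x = x and ends = ends, OF ssc cs L i] by linarith
  then show ?thesis by (simp add: left_diff_distrib)
qed

theorem theorem4:
  fixes ends :: "'e::finite \<Rightarrow> 'n::finite set"
    and A :: "real^'e^'n"
    and f :: "'n \<Rightarrow> real \<Rightarrow> real"
    and M \<mu> :: "'n \<Rightarrow> real"
    and F :: "real^'e \<Rightarrow> real"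
    and L :: "'e \<Rightarrow> real"
    and lambda_star x0 :: "real^'e"
    and P :: "'a measure"
    and node :: "nat \<Rightarrow> 'a \<Rightarrow> 'n"
    and edge :: "nat \<Rightarrow> 'a \<Rightarrow> 'e"
    and X :: "nat \<Rightarrow> 'a \<Rightarrow> real^'e"
  defines "F \<equiv> dual_objective f A"
  assumes "incidence_matrix ends A"
    and "\<And>i. incident ends i \<noteq> {}"
    and "\<And>i. smooth_strongly_convex (M i) (\<mu> i) (f i)"
    and "coordinate_smooth F L"
    and "\<And>x. F lambda_star \<le> F x"
    and "slcd_process P ends F L x0 node edge X"
  shows "(\<forall>k. AE \<omega> in P.
            real_cond_exp P (vimage_algebra (space P) (X k) borel) (\<lambda>\<omega>. F (X (Suc k) \<omega>)) \<omega>
              - F lambda_star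
            \<le> (1 - sigma_L F A ends L / real CARD('n)) * (F (X k \<omega>) - F lambda_star))
       \<and> sigma_A_spectral A M * Min (range (edge_weight ends L)) \<le> sigma_L F A ends L
       \<and> sigma_A_spectral A M \<le> sigma_A F A
       \<and> sigma_A F A * Min (range (edge_weight ends L)) \<le> sigma_L F A ends L
       \<and> sigma_L F A ends L \<le> sigma_A F A * Max (range (edge_weight ends L))"
proof -
  note inc = assms(2) and noniso = assms(3) and ssc = assms(4) and proc = assms(7)
  note cs = assms(5)[unfolded F_def]
  have L: "0 < L l" for l
  proof -
    obtain i where "A $ i $ l = 1" using incidence_matrix_column[OF inc] .
    then show ?thesis using coordinate_constant_pos[OF ssc cs, of i l] by simp
  qed
  have "ends l \<noteq> {}" for l by (rule incidence_matrix_column[OF inc, of l]) blast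
  then have w: "0 < edge_weight ends L l" for l using edge_weight_pos[of L ends l] L by blast
  note \<sigma> = strong_convexity_constant_comparison[where f = f and M = M, OF ssc w
      row_space_incidence_matrix[OF inc], folded F_def]
  have "AE \<omega> in P.
      real_cond_exp P (vimage_algebra (space P) (X k) borel) (\<lambda>\<omega>. F (X (Suc k) \<omega>)) \<omega> - F lambda_star
      \<le> (1 - sigma_L F A ends L / real CARD('n)) * (F (X k \<omega>) - F lambda_star)" for k
  proof -
    interpret prob_space P using proc by (simp add: slcd_process_def)
    have law: "distr P (count_space UNIV) (\<lambda>\<omega>. (node k \<omega>, edge k \<omega>)) = measure_pmf (slcd_draw ends L)"
      using proc by (simp add: slcd_process_def)
    have "AE \<omega> in P. real_cond_exp P (vimage_algebra (space P) (X k) borel) (\<lambda>\<omega>. F (X (Suc k) \<omega>)) \<omega>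
      = measure_pmf.expectation (slcd_draw ends L) (\<lambda>z. F (coordinate_step F L (snd z) (X k \<omega>)))"
      by (rule real_cond_exp_indep_finite[OF slcd_process_past[OF proc] law])
        (simp add: slcd_process_iterate(1)[OF proc])
    then show ?thesis
    proof eventually_elim
      case (elim \<omega>)
      then show ?case
        using expected_contraction[where f = f, OF ssc cs L noniso w \<sigma>(2,1)[unfolded F_def]]
        by (simp add: F_def)
    qed
  qed
  then show ?thesis using \<sigma>(3-6) by blast
qed

end
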